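(* Suppose that for each $n\ge1$, $(\mathcal X_i)_{i\in\mathbb N}$ and $(\mathcal X_i^n)_{i\in\mathbb N}$ are two sequences of $\mathcal H$-valued i.i.d. random variables with $\|\mathcal X_i\|_{\mathcal H},\|\mathcal X_i^n\|_{\mathcal H}\in L^2(\mathbb P)$ for all $n,i\ge1$. Then $\mathcal L(t)=\sum_{i=1}^{N(t)}\mathcal X_i$ and $\mathcal L^n(t)=\sum_{i=1}^{N(t)}\mathcal X_i^n$ are square-integrable compound Poisson processes. Suppose furthermore that $\mathcal V$ and $\mathcal V^n$ are the variance processes given by $$d\mathcal V(t)=\mathfrak C\mathcal V(t)\,dt+d\mathcal L(t),\ \ \mathcal V(0)=\mathcal V_0,\qquad d\mathcal V^n(t)=\mathfrak C^n\mathcal V^n(t)\,dt+d\mathcal L^n(t),\ \ \mathcal V^n(0)=\mathcal V^n_0,$$ where $\mathfrak C^n=\mathfrak C\in L(\mathcal H)$ for all $n\ge1$, and $\mathcal L$ and $\mathcal L^n$ are driven by the same Poisson process $N$. Then for every $T>0$, $$\mathbb E\Big[\sup_{0\le t\le T}\|\mathcal V(t)-\mathcal V^n(t)\|_{\mathcal H}^2\Big]\le C_0(T)\,\mathbb E\big[\|\mathcal V_0-\mathcal V_0^n\|_{\mathcal H}^2\big]+C_1(T)\,\mathbb E\big[\|\mathcal X_1-\mathcal X_1^n\|_{\mathcal H}^2\big],$$ where $C_0(T)=2e^{2T\|\mathfrak C\|_{\mathrm{op}}}$ and $C_1(T)=2e^{2T\|\mathfrak C\|_{\mathrm{op}}}\,T\lambda(1+\lambda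 T)\,e^{2T\|\mathfrak C\|_{\mathrm{op}}}$.
   Context: $H$ is a separable real Hilbert space and $\mathcal H=L_{HS}(H)$ is the Hilbert space of Hilbert-Schmidt operators on $H$ with norm $\|\cdot\|_{\mathcal H}$. $L(\mathcal H)$ is the Banach algebra of bounded linear operators on $\mathcal H$, with operator norm $\|\cdot\|_{\mathrm{op}}$. $N$ is a Poisson process with intensity $\lambda>0$ (right-continuous with left limits), independent of the jump sequences, as in the definition of a compound Poisson process. $\mathcal V_0,\mathcal V_0^n$ are $\mathcal H$-valued initial values. The solution of $d\mathcal V(t)=\mathfrak C\mathcal V(t)dt+d\mathcal L(t)$, $\mathcal V(0)=\mathcal V_0$, is $\mathcal V(t)=e^{\mathfrak Ct}\mathcal V_0+\int_0^te^{\mathfrak C(t-s)}d\mathcal L(s)=e^{\mathfrak Ct}\mathcal V_0+\sum_{i:T_i\le t}e^{\mathfrak C(t-T_i)}\mathcal X_i$, with $T_i$ the jump times of $N$; similarly for $\mathcal V^n$ with $\mathfrak C^n,\mathcal V_0^n,\mathcal X_i^n$.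
   Formalization: The formal statement adds that, for each n, the pairs (X_i, X_i^n) have the same joint law for all i, without which the inequality fails, and takes N to be independent of the two jump sequences jointly. *)

theory Defs
  imports "HOL-Probability.Probability"
begin

definition orthonormal_basis :: "'h::real_inner set \<Rightarrow> bool" where
  "orthonormal_basis E \<longleftrightarrow>
     (\<forall>e\<in>E. norm e = 1) \<and> pairwise orthogonal E \<and> closure (span E) = UNIV"

lemma onb_inner:
  assumes "pairwise orthogonal E" "\<forall>e\<in>E. norm e = 1" "a \<in> E" "b \<in> E"
  shows "inner a b = (if a = b then 1 else 0)"
  using assms by (auto simp: pairwise_def orthogonal_def norm_eq_sqrt_inner)

lemma norm_sum_onb:
  fixes E :: "'h::real_inner set"
  assumes E: "pairwise orthogonal E" "\<forall>e\<in>E. norm e = 1" and F: "finite F" "F \<subseteq> E"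
  shows "(norm (\<Sum>e\<in>F. c e *\<^sub>R e))\<^sup>2 = (\<Sum>e\<in>F. (c e)\<^sup>2)"
proof -
  have "(norm (\<Sum>e\<in>F. c e *\<^sub>R e))\<^sup>2 = (\<Sum>a\<in>F. \<Sum>b\<in>F. c a * (c b * inner a b))"
    unfolding power2_norm_eq_inner
    by (simp add: inner_sum_left inner_sum_right sum_distrib_left inner_commute mult.left_commute)
  also have "\<dots> = (\<Sum>a\<in>F. \<Sum>b\<in>F. if b = a then c a * c a else 0)"
    using onb_inner[OF E] F(2) by (intro sum.cong refl) (auto simp: subset_iff)
  also have "\<dots> = (\<Sum>e\<in>F. (c e)\<^sup>2)"
    using F by (simp add: power2_eq_square)
  finally show ?thesis .
qed

lemma norm_diff_sum_onb:
  fixes E :: "'h::real_inner set"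
  assumes E: "pairwise orthogonal E" "\<forall>e\<in>E. norm e = 1" and F: "finite F" "F \<subseteq> E"
  shows "(norm (x - (\<Sum>e\<in>F. c e *\<^sub>R e)))\<^sup>2 =
    (norm x)\<^sup>2 - (\<Sum>e\<in>F. (inner x e)\<^sup>2) + (\<Sum>e\<in>F. (c e - inner x e)\<^sup>2)"
proof -
  have "(norm (x - (\<Sum>e\<in>F. c e *\<^sub>R e)))\<^sup>2 =
    (norm x)\<^sup>2 - 2 * inner x (\<Sum>e\<in>F. c e *\<^sub>R e) + (norm (\<Sum>e\<in>F. c e *\<^sub>R e))\<^sup>2"
    unfolding power2_norm_eq_inner by (simp add: inner_diff_left inner_diff_right inner_commute)
  also have "inner x (\<Sum>e\<in>F. c e *\<^sub>R e) = (\<Sum>e\<in>F. c e * inner x e)"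
    by (simp add: inner_sum_right)
  also have "(norm (\<Sum>e\<in>F. c e *\<^sub>R e))\<^sup>2 = (\<Sum>e\<in>F. (c e)\<^sup>2)"
    using norm_sum_onb[OF E F] .
  finally show ?thesis
    by (simp add: power2_diff sum.distrib sum_subtractf sum_distrib_left algebra_simps)
qed

lemma parseval:
  fixes E :: "'h::real_inner set"
  assumes "orthonormal_basis E"
  shows "((\<lambda>e. (inner x e)\<^sup>2) has_sum (norm x)\<^sup>2) E"
proof -
  have E: "pairwise orthogonal E" "\<forall>e\<in>E. norm e = 1" and cl: "closure (span E) = UNIV"
    using assms by (auto simp: orthonormal_basis_def)
  have bessel: "(\<Sum>e\<in>F. (inner x e)\<^sup>2) \<le> (norm x)\<^sup>2" if "finite F" "F \<subseteq> E" for F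
    using norm_diff_sum_onb[OF E that, of x "\<lambda>e. inner x e"]
      zero_le_power2[of "norm (x - (\<Sum>e\<in>F. inner x e *\<^sub>R e))"] by simp
  show ?thesis
    unfolding has_sum_def tendsto_iff eventually_finite_subsets_at_top
  proof (intro allI impI)
    fix \<epsilon> :: real assume "\<epsilon> > 0"
    then have "x \<in> closure (span E)" "sqrt \<epsilon> > 0" using cl by auto
    then obtain y where y: "y \<in> span E" "dist y x < sqrt \<epsilon>"
      unfolding closure_approachable by blast
    obtain F c where F: "finite F" "F \<subseteq> E" "y = (\<Sum>e\<in>F. c e *\<^sub>R e)"
      using y(1) unfolding span_explicit by auto
    show "\<exists>X. finite X \<and> X \<subseteq> E \<and> (\<forall>Y. finite Y \<and> X \<subseteq> Y \<and> Y \<subseteq> E \<longrightarrow>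
        dist (\<Sum>e\<in>Y. (inner x e)\<^sup>2) ((norm x)\<^sup>2) < \<epsilon>)"
    proof (intro exI[of _ F] conjI allI impI)
      fix Y assume Y: "finite Y \<and> F \<subseteq> Y \<and> Y \<subseteq> E"
      have "(norm (x - y))\<^sup>2 < \<epsilon>"
        using power_strict_mono[OF y(2), of 2] \<open>\<epsilon> > 0\<close> by (simp add: dist_norm norm_minus_commute)
      moreover have "(norm (x - y))\<^sup>2 \<ge> (norm x)\<^sup>2 - (\<Sum>e\<in>F. (inner x e)\<^sup>2)"
        using norm_diff_sum_onb[OF E F(1,2), of x c] F(3) by (simp add: sum_nonneg)
      moreover have "(\<Sum>e\<in>F. (inner x e)\<^sup>2) \<le> (\<Sum>e\<in>Y. (inner x e)\<^sup>2)"
        using Y by (intro sum_mono2) auto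
      moreover have "(\<Sum>e\<in>Y. (inner x e)\<^sup>2) \<le> (norm x)\<^sup>2" using bessel Y by blast
      ultimately show "dist (\<Sum>e\<in>Y. (inner x e)\<^sup>2) ((norm x)\<^sup>2) < \<epsilon>"
        unfolding dist_real_def by linarith
    qed (use F in auto)
  qed
qed

lemma ex_orthonormal_basis:
  "\<exists>E :: 'h::{real_inner, second_countable_topology} set. orthonormal_basis E"
proof -
  obtain D :: "'h set" where D: "countable D" "\<And>X. open X \<Longrightarrow> X \<noteq> {} \<Longrightarrow> \<exists>d\<in>D. d \<in> X"
    using countable_dense_exists by metis
  have Dne: "D \<noteq> {}" using D(2)[of UNIV] by auto
  define d where "d = from_nat_into D"
  have ranged: "range d = D" using D(1) Dne by (simp add: d_def range_from_nat_into)
  define P where "P = (\<lambda>(n::nat) S :: 'h set. finite S \<and> pairwise orthogonal S \<and> (\<forall>e\<in>S. norm e = 1)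
    \<and> d ` {..<n} \<subseteq> span S)"
  have "\<exists>S. \<forall>n. P n (S n) \<and> S n \<subseteq> S (Suc n)"
  proof (rule dependent_nat_choice)
    show "\<exists>S. P 0 S" by (auto simp: P_def pairwise_def intro!: exI[of _ "{}"])
  next
    fix S n assume S: "P n S"
    then have S': "finite S" "pairwise orthogonal S" "\<forall>e\<in>S. norm e = 1" by (auto simp: P_def)
    define y where "y = d n - (\<Sum>e\<in>S. inner (d n) e *\<^sub>R e)"
    have orth: "inner y s = 0" if "s \<in> S" for s
    proof -
      have "inner (\<Sum>e\<in>S. inner (d n) e *\<^sub>R e) s = (\<Sum>e\<in>S. if e = s then inner (d n) s else 0)"
        unfolding inner_sum_left using onb_inner[OF S'(2,3) _ that] by (intro sum.cong) auto
      then show ?thesis using that S'(1) by (simp add: y_def inner_diff_left)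
    qed
    have inS: "(\<Sum>e\<in>S. inner (d n) e *\<^sub>R e) \<in> span T" if "S \<subseteq> T" for T
      using that by (intro span_sum span_scale span_base) auto
    show "\<exists>S'. P (Suc n) S' \<and> S \<subseteq> S'"
    proof (cases "y = 0")
      case True
      then have "d n \<in> span S" using inS[of S] by (simp add: y_def)
      then show ?thesis using S by (intro exI[of _ S]) (auto simp: P_def lessThan_Suc)
    next
      case False
      define u where "u = y /\<^sub>R norm y"
      have "norm u = 1" using False by (simp add: u_def)
      moreover have "pairwise orthogonal (insert u S)"
        using S'(2) orth by (auto simp: pairwise_insert orthogonal_def u_def inner_commute)
      moreover have "d n \<in> span (insert u S)"
      proof -
        have "y = norm y *\<^sub>R u" using False by (simp add: u_def)
        then have "y \<in> span (insert u S)" by (metis insertI1 span_base span_scale)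
        moreover have "d n = y + (\<Sum>e\<in>S. inner (d n) e *\<^sub>R e)" by (simp add: y_def)
        ultimately show ?thesis using inS[of "insert u S"] by (metis span_add subset_insertI)
      qed
      moreover have "span S \<subseteq> span (insert u S)" by (intro span_mono) auto
      ultimately show ?thesis using S
        by (intro exI[of _ "insert u S"]) (auto simp: P_def lessThan_Suc)
    qed
  qed
  then obtain S where S: "\<And>n. P n (S n)" "\<And>n. S n \<subseteq> S (Suc n)" by blast
  have mono: "S m \<subseteq> S n" if "m \<le> n" for m n using lift_Suc_mono_le[of S, OF S(2) that] .
  let ?E = "\<Union>n. S n"
  have "norm e = 1" if "e \<in> ?E" for e using S(1) that by (auto simp: P_def)
  moreover have "pairwise orthogonal ?E"
  proof (unfold pairwise_def, intro ballI impI)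
    fix a b assume "a \<in> ?E" "b \<in> ?E" and ab: "a \<noteq> b"
    then obtain m n where "a \<in> S m" "b \<in> S n" by auto
    then have "a \<in> S (max m n)" "b \<in> S (max m n)" using mono[of m "max m n"] mono[of n "max m n"] by auto
    then show "orthogonal a b" using S(1)[of "max m n"] ab by (auto simp: P_def pairwise_def)
  qed
  moreover have "closure (span ?E) = UNIV"
  proof -
    have "D \<subseteq> span ?E"
    proof
      fix x assume "x \<in> D"
      then obtain n where "x = d n" using ranged by auto
      then have "x \<in> span (S (Suc n))" using S(1)[of "Suc n"] by (auto simp: P_def)
      then show "x \<in> span ?E" using span_mono[of "S (Suc n)" ?E] by blast
    qed
    moreover have "closure D = UNIV"
    proof (intro set_eqI iffI UNIV_I)
      fix x :: 'h
      show "x \<in> closure D" unfolding closure_approachable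
      proof (intro allI impI)
        fix r :: real assume "r > 0"
        then show "\<exists>y\<in>D. dist y x < r"
          using D(2)[of "ball x r"] by (auto simp: dist_commute)
      qed
    qed
    ultimately show ?thesis using closure_mono by blast
  qed
  ultimately show ?thesis unfolding orthonormal_basis_def by blast
qed

lemma countable_orthonormal_basis:
  fixes E :: "'h::{real_inner, second_countable_topology} set"
  assumes "orthonormal_basis E"
  shows "countable E"
proof -
  have E: "pairwise orthogonal E" "\<forall>e\<in>E. norm e = 1"
    using assms by (auto simp: orthonormal_basis_def)
  have d: "dist a b = sqrt 2" if "a \<in> E" "b \<in> E" "a \<noteq> b" for a b
    using onb_inner[OF E] that
    by (simp add: dist_norm norm_eq_sqrt_inner inner_diff_left inner_diff_right)
  have 1: "(1::real) < sqrt 2" by simp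
  have dis: "ball a (1/2::real) \<inter> ball b (1/2) = {}" if "a \<in> E" "b \<in> E" "a \<noteq> b" for a b
  proof (rule ccontr)
    assume "ball a (1/2) \<inter> ball b (1/2) \<noteq> {}"
    then obtain z where "dist a z < 1/2" "dist b z < 1/2" by auto
    then show False using d[OF that] 1 dist_triangle2[of a b z] by linarith
  qed
  have "countable ((\<lambda>a. ball a (1/2)) ` E)"
    by (rule countable_disjoint_open_subsets) (use dis in \<open>auto simp: pairwise_def disjnt_def simp del: mem_ball\<close>)
  moreover have "inj_on (\<lambda>a. ball a (1/2::real)) E"
  proof (rule inj_onI, rule ccontr)
    fix a b assume *: "a \<in> E" "b \<in> E" "ball a (1/2::real) = ball b (1/2)" "a \<noteq> b"
    have "a \<in> ball a (1/2)" by simp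
    then show False using dis[OF *(1,2,4)] *(3) by auto
  qed
  ultimately show ?thesis using countable_image_inj_on by blast
qed

(* The sum does not depend on the orthonormal basis, see hs_has_sum_any_basis below. *)
definition hilbert_schmidt :: "('h::real_inner \<Rightarrow>\<^sub>L 'h) \<Rightarrow> bool" where
  "hilbert_schmidt A \<longleftrightarrow>
     (\<exists>E. orthonormal_basis E \<and> (\<lambda>e. (norm (blinfun_apply A e))\<^sup>2) summable_on E)"

lemma functional_le:
  fixes f :: "'h::real_inner \<Rightarrow> real"
  assumes E: "orthonormal_basis E" and f: "bounded_linear f"
    and b: "\<And>F. finite F \<Longrightarrow> F \<subseteq> E \<Longrightarrow> (\<Sum>e\<in>F. (f e)\<^sup>2) \<le> S"
  shows "\<bar>f x\<bar> \<le> norm x * sqrt S"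
proof -
  interpret f: bounded_linear f by fact
  have E': "pairwise orthogonal E" "\<forall>e\<in>E. norm e = 1" "closure (span E) = UNIV"
    using E by (auto simp: orthonormal_basis_def)
  have "span E \<subseteq> {x. \<bar>f x\<bar> \<le> norm x * sqrt S}"
  proof safe
    fix x assume "x \<in> span E"
    then obtain F c where F: "finite F" "F \<subseteq> E" "x = (\<Sum>e\<in>F. c e *\<^sub>R e)"
      unfolding span_explicit by auto
    have "\<bar>f x\<bar> \<le> (\<Sum>e\<in>F. \<bar>c e\<bar> * \<bar>f e\<bar>)"
      unfolding F(3) f.sum f.scaleR by (rule order_trans[OF sum_abs]) (simp add: abs_mult)
    also have "\<dots> \<le> L2_set c F * L2_set f F" by (rule L2_set_mult_ineq)
    also have "L2_set c F = norm x"
      using norm_sum_onb[OF E'(1,2) F(1,2), of c] F(3) unfolding L2_set_def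
      by (metis norm_ge_zero real_sqrt_abs abs_of_nonneg)
    also have "L2_set f F \<le> sqrt S" unfolding L2_set_def using b[OF F(1,2)] by simp
    finally show "\<bar>f x\<bar> \<le> norm x * sqrt S" by (simp add: mult_left_mono)
  qed
  moreover have "closed {x. \<bar>f x\<bar> \<le> norm x * sqrt S}"
    by (intro closed_Collect_le continuous_intros f.continuous_on)
  ultimately have "closure (span E) \<subseteq> {x. \<bar>f x\<bar> \<le> norm x * sqrt S}" by (rule closure_minimal)
  then show ?thesis using E'(3) by auto
qed

lemma functional_sum_le:
  fixes f :: "'h::real_inner \<Rightarrow> real"
  assumes E: "orthonormal_basis E" and E': "orthonormal_basis E'" and f: "bounded_linear f"
    and s: "((\<lambda>e. (f e)\<^sup>2) has_sum S) E" and F: "finite F" "F \<subseteq> E'"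
  shows "(\<Sum>e\<in>F. (f e)\<^sup>2) \<le> S"
proof -
  interpret f: bounded_linear f by fact
  define x where "x = (\<Sum>e\<in>F. f e *\<^sub>R e)"
  let ?T = "\<Sum>e\<in>F. (f e)\<^sup>2"
  have "(\<Sum>e\<in>G. (f e)\<^sup>2) \<le> S" if "finite G" "G \<subseteq> E" for G
    using finite_sum_le_has_sum[OF s that] by auto
  from functional_le[OF E f this, of x] have "\<bar>f x\<bar> \<le> norm x * sqrt S" by simp
  moreover have "f x = ?T" unfolding x_def f.sum f.scaleR by (simp add: power2_eq_square)
  moreover have nx: "(norm x)\<^sup>2 = ?T"
    unfolding x_def by (rule norm_sum_onb[of E']) (use E' F in \<open>auto simp: orthonormal_basis_def\<close>)
  ultimately have *: "(norm x)\<^sup>2 \<le> norm x * sqrt S" by simp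
  have "S \<ge> 0" using has_sum_nonneg[OF s] by simp
  have "norm x \<le> sqrt S"
  proof (cases "norm x = 0")
    case False
    then show ?thesis using * by (simp add: power2_eq_square mult_le_cancel_left)
  qed (simp add: \<open>S \<ge> 0\<close>)
  then have "(norm x)\<^sup>2 \<le> (sqrt S)\<^sup>2" by (intro power_mono) auto
  then show ?thesis using nx \<open>S \<ge> 0\<close> by simp
qed

lemma hs_sum_le:
  fixes A :: "'h::real_inner \<Rightarrow>\<^sub>L 'h"
  assumes E: "orthonormal_basis E" and E': "orthonormal_basis E'"
    and s: "((\<lambda>e. (norm (blinfun_apply A e))\<^sup>2) has_sum S) E" and F: "finite F" "F \<subseteq> E'"
  shows "(\<Sum>e\<in>F. (norm (blinfun_apply A e))\<^sup>2) \<le> S"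
proof -
  define a where "a = (\<lambda>(e, c). (inner (blinfun_apply A e) c)\<^sup>2)"
  have p: "((\<lambda>c. a (e, c)) has_sum (norm (blinfun_apply A e))\<^sup>2) E" for e
    using parseval[OF E, of "blinfun_apply A e"] by (simp add: a_def)
  have "a summable_on E \<times> E"
  proof (rule nonneg_bdd_above_summable_on)
    show "bdd_above (sum a ` {G. G \<subseteq> E \<times> E \<and> finite G})"
    proof (rule bdd_aboveI2)
      fix G assume G: "G \<in> {G. G \<subseteq> E \<times> E \<and> finite G}"
      have "sum a G \<le> sum a (fst ` G \<times> snd ` G)"
        using G subset_fst_snd[of G]
        by (intro sum_mono2) (auto simp: a_def)
      also have "\<dots> = (\<Sum>e\<in>fst ` G. \<Sum>c\<in>snd ` G. a (e, c))" by (simp add: sum.cartesian_product)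
      also have "\<dots> \<le> (\<Sum>e\<in>fst ` G. (norm (blinfun_apply A e))\<^sup>2)"
        using G by (intro sum_mono finite_sum_le_has_sum[OF p]) (auto simp: a_def)
      also have "\<dots> \<le> S"
        using G by (intro finite_sum_le_has_sum[OF s]) auto
      finally show "sum a G \<le> S" .
    qed
  qed (auto simp: a_def)
  then have "(a has_sum S) (E \<times> E)" by (intro has_sum_SigmaI[OF p s])
  then have sw: "((\<lambda>(c, e). a (e, c)) has_sum S) (E \<times> E)" by (subst (asm) has_sum_swap) simp
  define g where "g c = infsum (\<lambda>e. a (e, c)) E" for c
  have "(\<lambda>e. a (e, c)) summable_on E" if "c \<in> E" for c
    using summable_on_SigmaD1[of "\<lambda>c e. a (e, c)" E "\<lambda>_. E" c] sw that by (auto simp: summable_on_def)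
  then have gc: "((\<lambda>e. a (e, c)) has_sum g c) E" if "c \<in> E" for c
    using that by (simp add: g_def)
  have g: "(g has_sum S) E" using has_sum_SigmaD[OF sw, of g] gc by simp
  have h: "((\<lambda>c. \<Sum>e\<in>F. a (e, c)) has_sum (\<Sum>e\<in>F. (norm (blinfun_apply A e))\<^sup>2)) E"
    using F(1) by (induction F) (auto intro: has_sum_add p)
  show ?thesis
  proof (rule has_sum_mono[OF h g])
    fix c assume c: "c \<in> E"
    show "(\<Sum>e\<in>F. a (e, c)) \<le> g c"
      using functional_sum_le[OF E E' _ _ F, of "\<lambda>e. inner (blinfun_apply A e) c" "g c"] gc[OF c]
      by (simp add: a_def bounded_linear_inner_left_comp blinfun.bounded_linear_right)
  qed
qed

lemma hs_has_sum_any_basis: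
  fixes A :: "'h::real_inner \<Rightarrow>\<^sub>L 'h"
  assumes E: "orthonormal_basis E" and E': "orthonormal_basis E'"
    and s: "((\<lambda>e. (norm (blinfun_apply A e))\<^sup>2) has_sum S) E"
  shows "((\<lambda>e. (norm (blinfun_apply A e))\<^sup>2) has_sum S) E'"
proof -
  let ?f = "\<lambda>e. (norm (blinfun_apply A e))\<^sup>2"
  have "?f summable_on E'"
    by (rule nonneg_bdd_above_summable_on)
      (auto intro!: bdd_aboveI2[of _ _ S] hs_sum_le[OF E E' s])
  then obtain S' where S': "(?f has_sum S') E'" by (auto simp: summable_on_def)
  have "S' \<le> S" by (rule has_sum_le_finite_sums[OF S']) (rule hs_sum_le[OF E E' s])
  moreover have "S \<le> S'" by (rule has_sum_le_finite_sums[OF s]) (rule hs_sum_le[OF E' E S'])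
  ultimately show ?thesis using S' by simp
qed

lemma hilbert_schmidt_iff:
  assumes "orthonormal_basis E"
  shows "hilbert_schmidt A \<longleftrightarrow> (\<lambda>e. (norm (blinfun_apply A e))\<^sup>2) summable_on E"
  unfolding hilbert_schmidt_def summable_on_def using assms hs_has_sum_any_basis by blast

definition hs_basis :: "'h::{real_inner, second_countable_topology} set" where
  "hs_basis = (SOME E. orthonormal_basis E)"

lemma orthonormal_basis_hs_basis:
  "orthonormal_basis (hs_basis :: 'h::{real_inner, second_countable_topology} set)"
  unfolding hs_basis_def by (rule someI_ex) (rule ex_orthonormal_basis)

lemmas hilbert_schmidt_hs_basis = hilbert_schmidt_iff[OF orthonormal_basis_hs_basis]

typedef (overloaded) 'h hs_op =
  "{A :: 'h::{real_inner, banach, second_countable_topology} \<Rightarrow>\<^sub>L 'h. hilbert_schmidt A}"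
  morphisms hs_blinfun Abs_hs_op
  by (intro exI[of _ 0]) (simp add: hilbert_schmidt_hs_basis)

setup_lifting type_definition_hs_op

lemma hs_blinfun_surj: "hilbert_schmidt B \<Longrightarrow> \<exists>A. B = hs_blinfun A"
  by (metis Abs_hs_op_inverse mem_Collect_eq)

lemma hilbert_schmidt_hs_blinfun: "hilbert_schmidt (hs_blinfun A)"
  using hs_blinfun[of A] by simp

lemma hilbert_schmidt_add:
  fixes A B :: "'h::{real_inner, second_countable_topology} \<Rightarrow>\<^sub>L 'h"
  assumes "hilbert_schmidt A" "hilbert_schmidt B"
  shows "hilbert_schmidt (A + B)"
  unfolding hilbert_schmidt_hs_basis
proof (rule summable_on_comparison_test)
  show "(\<lambda>e. 2 * (norm (blinfun_apply A e))\<^sup>2 + 2 * (norm (blinfun_apply B e))\<^sup>2) summable_on hs_basis"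
    using assms unfolding hilbert_schmidt_hs_basis
    by (intro summable_on_add summable_on_cmult_right)
  fix e :: 'h
  have "(norm (blinfun_apply A e + blinfun_apply B e))\<^sup>2
      \<le> (norm (blinfun_apply A e) + norm (blinfun_apply B e))\<^sup>2"
    by (intro power_mono norm_triangle_ineq) auto
  also have "\<dots> \<le> 2 * (norm (blinfun_apply A e))\<^sup>2 + 2 * (norm (blinfun_apply B e))\<^sup>2"
    using zero_le_power2[of "norm (blinfun_apply A e) - norm (blinfun_apply B e)"]
    by (simp add: power2_diff power2_sum)
  finally show "(norm (blinfun_apply (A + B) e))\<^sup>2
      \<le> 2 * (norm (blinfun_apply A e))\<^sup>2 + 2 * (norm (blinfun_apply B e))\<^sup>2"
    by (simp add: blinfun.add_left)
qed auto

lemma hilbert_schmidt_scaleR: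
  fixes A :: "'h::{real_inner, second_countable_topology} \<Rightarrow>\<^sub>L 'h"
  assumes "hilbert_schmidt A"
  shows "hilbert_schmidt (r *\<^sub>R A)"
  using summable_on_cmult_right[OF assms[unfolded hilbert_schmidt_hs_basis], of "r\<^sup>2"]
  unfolding hilbert_schmidt_hs_basis by (simp add: blinfun.scaleR_left power_mult_distrib)

lemma hilbert_schmidt_uminus:
  fixes A :: "'h::{real_inner, second_countable_topology} \<Rightarrow>\<^sub>L 'h"
  assumes "hilbert_schmidt A"
  shows "hilbert_schmidt (- A)"
  using hilbert_schmidt_scaleR[OF assms, of "-1"] by simp

lemma hilbert_schmidt_diff:
  fixes A :: "'h::{real_inner, second_countable_topology} \<Rightarrow>\<^sub>L 'h"
  assumes "hilbert_schmidt A" "hilbert_schmidt B"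
  shows "hilbert_schmidt (A - B)"
  using hilbert_schmidt_add[OF assms(1) hilbert_schmidt_uminus[OF assms(2)]] by simp

lemma summable_on_hs_inner:
  fixes A B :: "'h::{real_inner, second_countable_topology} \<Rightarrow>\<^sub>L 'h"
  assumes "hilbert_schmidt A" "hilbert_schmidt B"
  shows "(\<lambda>e. inner (blinfun_apply A e) (blinfun_apply B e)) summable_on hs_basis"
proof -
  have eq: "inner (blinfun_apply A e) (blinfun_apply B e) = ((norm (blinfun_apply (A + B) e))\<^sup>2 +
    (- 1) * ((norm (blinfun_apply A e))\<^sup>2 + (norm (blinfun_apply B e))\<^sup>2)) * (1/2)" for e
    unfolding power2_norm_eq_inner
    by (simp add: blinfun.add_left inner_add_left inner_add_right inner_commute)
  show ?thesis unfolding eq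
    using assms hilbert_schmidt_add[OF assms] unfolding hilbert_schmidt_hs_basis
    by (intro summable_on_cmult_left summable_on_add summable_on_cmult_right)
qed

instantiation hs_op :: ("{real_inner, banach, second_countable_topology}") real_vector
begin

lift_definition zero_hs_op :: "'a hs_op" is 0
  by (simp add: hilbert_schmidt_hs_basis)

lift_definition plus_hs_op :: "'a hs_op \<Rightarrow> 'a hs_op \<Rightarrow> 'a hs_op" is "(+)"
  by (rule hilbert_schmidt_add)

lift_definition minus_hs_op :: "'a hs_op \<Rightarrow> 'a hs_op \<Rightarrow> 'a hs_op" is "(-)"
  by (rule hilbert_schmidt_diff)

lift_definition uminus_hs_op :: "'a hs_op \<Rightarrow> 'a hs_op" is uminus
  by (rule hilbert_schmidt_uminus)

lift_definition scaleR_hs_op :: "real \<Rightarrow> 'a hs_op \<Rightarrow> 'a hs_op" is "(*\<^sub>R)"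
  by (rule hilbert_schmidt_scaleR)

instance
  by standard (transfer; simp add: algebra_simps)+

end

instantiation hs_op :: ("{real_inner, banach, second_countable_topology}") real_inner
begin

(* The value does not depend on the choice of the basis, see inner_hs_op_has_sum below. *)
definition inner_hs_op :: "'a hs_op \<Rightarrow> 'a hs_op \<Rightarrow> real" where
  "inner_hs_op A B =
     (\<Sum>\<^sub>\<infinity>e\<in>hs_basis. inner (blinfun_apply (hs_blinfun A) e) (blinfun_apply (hs_blinfun B) e))"

definition norm_hs_op :: "'a hs_op \<Rightarrow> real" where
  "norm_hs_op A = sqrt (inner A A)"

definition dist_hs_op :: "'a hs_op \<Rightarrow> 'a hs_op \<Rightarrow> real" where
  "dist_hs_op A B = norm (A - B)"

definition sgn_hs_op :: "'a hs_op \<Rightarrow> 'a hs_op" where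
  "sgn_hs_op A = A /\<^sub>R norm A"

definition uniformity_hs_op :: "('a hs_op \<times> 'a hs_op) filter" where
  "uniformity_hs_op = (INF e\<in>{0 <..}. principal {(A, B). dist A B < e})"

definition open_hs_op :: "'a hs_op set \<Rightarrow> bool" where
  "open_hs_op S = (\<forall>A\<in>S. \<forall>\<^sub>F (A', B) in uniformity. A' = A \<longrightarrow> B \<in> S)"

instance
proof
  fix A B C :: "'a hs_op" and r :: real
  show "dist A B = norm (A - B)" by (fact dist_hs_op_def)
  show "sgn A = A /\<^sub>R norm A" by (fact sgn_hs_op_def)
  show "uniformity = (INF e\<in>{0 <..}. principal {(A :: 'a hs_op, B). dist A B < e})"
    by (fact uniformity_hs_op_def)
  show "open S = (\<forall>A\<in>S. \<forall>\<^sub>F (A', B) in uniformity. A' = A \<longrightarrow> B \<in> S)" for S :: "'a hs_op set"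
    by (fact open_hs_op_def)
  show "inner A B = inner B A" unfolding inner_hs_op_def by (simp add: inner_commute)
  show "inner (A + B) C = inner A C + inner B C"
    unfolding inner_hs_op_def plus_hs_op.rep_eq blinfun.add_left inner_add_left
    by (intro infsum_add summable_on_hs_inner hilbert_schmidt_hs_blinfun)
  show "inner (r *\<^sub>R A) B = r * inner A B"
    unfolding inner_hs_op_def scaleR_hs_op.rep_eq blinfun.scaleR_left inner_scaleR_left
    by (intro infsum_cmult_right summable_on_hs_inner hilbert_schmidt_hs_blinfun)
  show "0 \<le> inner A A" unfolding inner_hs_op_def by (intro infsum_nonneg) simp
  show "norm A = sqrt (inner A A)" by (fact norm_hs_op_def)
  show "inner A A = 0 \<longleftrightarrow> A = 0"
  proof
    assume A: "inner A A = 0"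
    let ?A = "blinfun_apply (hs_blinfun A)"
    have z: "?A e = 0" if "e \<in> hs_basis" for e
      using nonneg_infsum_le_0D[of "\<lambda>e. inner (?A e) (?A e)" hs_basis e] A that
        summable_on_hs_inner[of "hs_blinfun A" "hs_blinfun A"] hilbert_schmidt_hs_blinfun[of A]
      by (simp add: inner_hs_op_def)
    have "?A x = 0" for x
    proof -
      have "span hs_basis \<subseteq> {x. ?A x = 0}"
        by (rule span_minimal) (auto simp: z subspace_def blinfun.add_right blinfun.scaleR_right)
      moreover have "closed {x. ?A x = 0}" by (intro closed_Collect_eq continuous_intros)
      ultimately have "closure (span hs_basis) \<subseteq> {x. ?A x = 0}" by (rule closure_minimal)
      then show ?thesis using orthonormal_basis_hs_basis[where ?'h='a] by (auto simp: orthonormal_basis_def)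
    qed
    then have "hs_blinfun A = 0" by (intro blinfun_eqI) simp
    then show "A = 0" by transfer simp
  next
    assume "A = 0"
    then show "inner A A = 0" unfolding inner_hs_op_def by (simp add: zero_hs_op.rep_eq)
  qed
qed

end

lemma norm_hs_op_has_sum:
  assumes "orthonormal_basis E"
  shows "((\<lambda>e. (norm (blinfun_apply (hs_blinfun A) e))\<^sup>2) has_sum (norm A)\<^sup>2) E"
proof -
  have "((\<lambda>e. (norm (blinfun_apply (hs_blinfun A) e))\<^sup>2) has_sum (norm A)\<^sup>2) hs_basis"
    unfolding norm_hs_op_def power2_norm_eq_inner
    using summable_on_hs_inner[of "hs_blinfun A" "hs_blinfun A"] hilbert_schmidt_hs_blinfun[of A]
    by (simp add: inner_hs_op_def infsum_nonneg)
  then show ?thesis by (rule hs_has_sum_any_basis[OF orthonormal_basis_hs_basis assms])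
qed

lemma inner_hs_op_has_sum:
  assumes "orthonormal_basis E"
  shows "((\<lambda>e. inner (blinfun_apply (hs_blinfun A) e) (blinfun_apply (hs_blinfun B) e))
    has_sum inner A B) E"
proof -
  have eq: "inner x y = ((norm (x + y))\<^sup>2 + (- 1) * ((norm x)\<^sup>2 + (norm y)\<^sup>2)) * (1/2)"
    for x y :: "'z::real_inner"
    unfolding power2_norm_eq_inner by (simp add: inner_add_left inner_add_right inner_commute)
  have "((\<lambda>e. (norm (blinfun_apply (hs_blinfun A) e + blinfun_apply (hs_blinfun B) e))\<^sup>2)
    has_sum (norm (A + B))\<^sup>2) E"
    using norm_hs_op_has_sum[OF assms, of "A + B"] by (simp add: plus_hs_op.rep_eq blinfun.add_left)
  then show ?thesis unfolding eq[of "blinfun_apply _ _"] eq[of A]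
    by (intro has_sum_cmult_left has_sum_add has_sum_cmult_right norm_hs_op_has_sum[OF assms])
qed

lemma norm_hs_blinfun_le:
  fixes A :: "'h::{real_inner, banach, second_countable_topology} hs_op"
  shows "norm (hs_blinfun A) \<le> norm A"
proof (rule norm_blinfun_bound)
  fix x
  let ?A = "blinfun_apply (hs_blinfun A)"
  let ?y = "?A x"
  have "\<bar>inner (?A x) ?y\<bar> \<le> norm x * sqrt ((norm ?y)\<^sup>2 * (norm A)\<^sup>2)"
  proof (rule functional_le[OF orthonormal_basis_hs_basis, where f = "\<lambda>z. inner (?A z) ?y"])
    show "bounded_linear (\<lambda>x. inner (?A x) ?y)"
      by (simp add: bounded_linear_inner_left_comp blinfun.bounded_linear_right)
    fix F :: "'h set" assume F: "finite F" "F \<subseteq> hs_basis"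
    have "(\<Sum>e\<in>F. (inner (?A e) ?y)\<^sup>2) \<le> (\<Sum>e\<in>F. (norm ?y)\<^sup>2 * (norm (?A e))\<^sup>2)"
      by (intro sum_mono) (use Cauchy_Schwarz_ineq2 in
        \<open>metis abs_le_square_iff abs_norm_cancel abs_mult mult.commute power_mult_distrib\<close>)
    also have "\<dots> \<le> (norm ?y)\<^sup>2 * (norm A)\<^sup>2"
      unfolding sum_distrib_left[symmetric] using F
      by (intro mult_left_mono finite_sum_le_has_sum[OF norm_hs_op_has_sum[OF orthonormal_basis_hs_basis]]) auto
    finally show "(\<Sum>e\<in>F. (inner (?A e) ?y)\<^sup>2) \<le> (norm ?y)\<^sup>2 * (norm A)\<^sup>2" .
  qed
  then have "norm ?y * norm ?y \<le> norm ?y * (norm A * norm x)"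
    unfolding real_sqrt_mult
    by (simp add: power2_norm_eq_inner[symmetric] mult_ac) (simp add: power2_eq_square)
  then show "norm ?y \<le> norm A * norm x"
    by (cases "norm ?y = 0") (simp_all add: mult_le_cancel_left)
qed simp

lemma norm_hs_op_le:
  fixes A :: "'h::{real_inner, banach, second_countable_topology} hs_op"
  assumes "\<And>F. finite F \<Longrightarrow> F \<subseteq> hs_basis \<Longrightarrow> (\<Sum>e\<in>F. (norm (blinfun_apply (hs_blinfun A) e))\<^sup>2) \<le> r\<^sup>2"
    and "0 \<le> r"
  shows "norm A \<le> r"
proof -
  have "(norm A)\<^sup>2 \<le> r\<^sup>2"
    by (rule has_sum_le_finite_sums[OF norm_hs_op_has_sum[OF orthonormal_basis_hs_basis]]) (rule assms)
  then show ?thesis using assms(2) by (simp add: power2_le_iff_abs_le abs_le_square_iff)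
qed

instance hs_op :: ("{real_inner, banach, second_countable_topology}") banach
proof
  fix X :: "nat \<Rightarrow> 'a hs_op"
  assume X: "Cauchy X"
  let ?X = "\<lambda>n. blinfun_apply (hs_blinfun (X n))"
  have "Cauchy (\<lambda>n. hs_blinfun (X n))"
  proof (rule metric_CauchyI)
    fix e :: real assume "0 < e"
    then obtain N where "\<And>m n. m \<ge> N \<Longrightarrow> n \<ge> N \<Longrightarrow> dist (X m) (X n) < e"
      using metric_CauchyD[OF X] by blast
    then show "\<exists>N. \<forall>m\<ge>N. \<forall>n\<ge>N. dist (hs_blinfun (X m)) (hs_blinfun (X n)) < e"
      using norm_hs_blinfun_le[of "X m - X n" for m n]
      by (intro exI[of _ N]) (simp add: dist_norm minus_hs_op.rep_eq, blast intro: le_less_trans)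
  qed
  then obtain L where L: "(\<lambda>n. hs_blinfun (X n)) \<longlonglongrightarrow> L"
    using Cauchy_convergent_iff convergent_def by blast
  have Le: "(\<lambda>n. ?X n e) \<longlonglongrightarrow> blinfun_apply L e" for e
    by (intro tendsto_intros L)
  have key: "\<exists>N. \<forall>n\<ge>N. \<forall>F. finite F \<longrightarrow> F \<subseteq> hs_basis \<longrightarrow>
      (\<Sum>e\<in>F. (norm (?X n e - blinfun_apply L e))\<^sup>2) \<le> r\<^sup>2" if "r > 0" for r :: real
  proof -
    obtain N where N: "\<And>m n. m \<ge> N \<Longrightarrow> n \<ge> N \<Longrightarrow> dist (X m) (X n) < r"
      using metric_CauchyD[OF X \<open>r > 0\<close>] by blast
    have "(\<Sum>e\<in>F. (norm (?X n e - blinfun_apply L e))\<^sup>2) \<le> r\<^sup>2"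
      if n: "n \<ge> N" and F: "finite F" "F \<subseteq> hs_basis" for n F
    proof (rule tendsto_upperbound)
      show "(\<lambda>m. \<Sum>e\<in>F. (norm (?X n e - ?X m e))\<^sup>2) \<longlonglongrightarrow> (\<Sum>e\<in>F. (norm (?X n e - blinfun_apply L e))\<^sup>2)"
        by (intro tendsto_intros Le)
      show "\<forall>\<^sub>F m in sequentially. (\<Sum>e\<in>F. (norm (?X n e - ?X m e))\<^sup>2) \<le> r\<^sup>2"
        unfolding eventually_sequentially
      proof (intro exI[of _ N] allI impI)
        fix m assume "m \<ge> N"
        then have "norm (X n - X m) \<le> r" using N[OF n] by (force simp: dist_norm)
        then have "(norm (X n - X m))\<^sup>2 \<le> r\<^sup>2" by (intro power_mono) auto
        moreover have "(\<Sum>e\<in>F. (norm (?X n e - ?X m e))\<^sup>2) \<le> (norm (X n - X m))\<^sup>2"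
          using finite_sum_le_has_sum[OF norm_hs_op_has_sum[OF orthonormal_basis_hs_basis, of "X n - X m"] F]
          by (simp add: minus_hs_op.rep_eq blinfun.diff_left)
        ultimately show "(\<Sum>e\<in>F. (norm (?X n e - ?X m e))\<^sup>2) \<le> r\<^sup>2" by linarith
      qed
    qed simp
    then show ?thesis by blast
  qed
  have "hilbert_schmidt L"
  proof -
    obtain n where n: "\<And>F. finite F \<Longrightarrow> F \<subseteq> hs_basis \<Longrightarrow>
        (\<Sum>e\<in>F. (norm (?X n e - blinfun_apply L e))\<^sup>2) \<le> 1\<^sup>2"
      using key[of 1] by auto
    have "hilbert_schmidt (hs_blinfun (X n) - L)"
      unfolding hilbert_schmidt_hs_basis
      by (rule nonneg_bdd_above_summable_on)
        (auto intro!: bdd_aboveI2[of _ _ 1] n[simplified] simp: blinfun.diff_left)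
    from hilbert_schmidt_diff[OF hilbert_schmidt_hs_blinfun[of "X n"] this] show ?thesis by simp
  qed
  from hs_blinfun_surj[OF this] obtain A where A: "L = hs_blinfun A" ..
  have "X \<longlonglongrightarrow> A"
  proof (rule metric_LIMSEQ_I)
    fix r :: real assume "r > 0"
    then have "r / 2 > 0" by simp
    from key[OF this] obtain N where N: "\<forall>n\<ge>N. \<forall>F. finite F \<longrightarrow> F \<subseteq> hs_basis \<longrightarrow>
        (\<Sum>e\<in>F. (norm (?X n e - blinfun_apply L e))\<^sup>2) \<le> (r/2)\<^sup>2" by blast
    have "dist (X n) A < r" if "n \<ge> N" for n
    proof -
      have "norm (X n - A) \<le> r/2"
      proof (rule norm_hs_op_le)
        fix F :: "'a set" assume "finite F" "F \<subseteq> hs_basis"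
        then show "(\<Sum>e\<in>F. (norm (blinfun_apply (hs_blinfun (X n - A)) e))\<^sup>2) \<le> (r/2)\<^sup>2"
          using N[rule_format, OF that] unfolding A minus_hs_op.rep_eq blinfun.diff_left by blast
      qed (use \<open>r > 0\<close> in simp)
      then show ?thesis using \<open>r > 0\<close> by (simp add: dist_norm)
    qed
    then show "\<exists>N. \<forall>n\<ge>N. dist (X n) A < r" by blast
  qed
  then show "convergent X" by (auto simp: convergent_def)
qed

lemma ex_finite_rank_hs_op:
  fixes d :: "'h::{real_inner, banach, second_countable_topology} \<Rightarrow> 'h"
  assumes F: "finite F" "F \<subseteq> hs_basis"
  shows "\<exists>A. \<forall>e\<in>hs_basis. blinfun_apply (hs_blinfun A) e = (if e \<in> F then d e else 0)"
proof -
  have "bounded_linear (\<lambda>x. \<Sum>e\<in>F. inner x e *\<^sub>R d e)"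
    by (intro bounded_linear_sum bounded_linear_scaleR_const bounded_linear_inner_left)
  then obtain B where B: "blinfun_apply B = (\<lambda>x. \<Sum>e\<in>F. inner x e *\<^sub>R d e)"
    using bounded_linear_Blinfun_apply by blast
  have Be: "blinfun_apply B b = (if b \<in> F then d b else 0)" if "b \<in> hs_basis" for b
  proof -
    have "blinfun_apply B b = (\<Sum>e\<in>F. if e = b then d b else 0)"
      unfolding B using onb_inner[of "hs_basis :: 'h set" b] orthonormal_basis_hs_basis[where ?'h='h] that F
      by (intro sum.cong) (auto simp: orthonormal_basis_def subset_iff)
    then show ?thesis using F by simp
  qed
  have "hilbert_schmidt B"
    unfolding hilbert_schmidt_hs_basis
    using summable_on_cong_neutral[of hs_basis F "\<lambda>e. (norm (blinfun_apply B e))\<^sup>2"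
        "\<lambda>e. (norm (blinfun_apply B e))\<^sup>2"] F Be
    by (force intro: summable_on_finite)
  from hs_blinfun_surj[OF this] obtain A where "B = hs_blinfun A" ..
  then show ?thesis using Be by (intro exI[of _ A]) simp
qed

instance hs_op :: ("{real_inner, banach, second_countable_topology}") second_countable_topology
proof
  obtain D :: "'a set" where D: "countable D" "\<And>X. open X \<Longrightarrow> X \<noteq> {} \<Longrightarrow> \<exists>d\<in>D. d \<in> X"
    using countable_dense_exists by metis
  have cB: "countable (hs_basis :: 'a set)"
    by (rule countable_orthonormal_basis[OF orthonormal_basis_hs_basis])
  define I where "I = (SIGMA F:{F. finite F \<and> F \<subseteq> (hs_basis :: 'a set)}. F \<rightarrow>\<^sub>E D)"
  define op where "op = (\<lambda>(F, d). SOME A. \<forall>e\<in>hs_basis. blinfun_apply (hs_blinfun A) e = (if e \<in> F then d e else (0::'a)))"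
  have op: "blinfun_apply (hs_blinfun (op (F, d))) e = (if e \<in> F then d e else 0)"
    if "finite F" "F \<subseteq> hs_basis" "e \<in> hs_basis" for F d e
    using someI_ex[OF ex_finite_rank_hs_op[OF that(1,2), of d]] that(3) by (simp add: op_def)
  have "countable I" unfolding I_def
    using D(1) by (intro countable_SIGMA countable_Collect_finite_subset cB countable_PiE) auto
  define Q where "Q = op ` I"
  have cQ: "countable Q" using \<open>countable I\<close> by (simp add: Q_def)
  have dense: "\<exists>q\<in>Q. dist q A < r" if "r > 0" for A r
  proof -
    let ?A = "blinfun_apply (hs_blinfun A)"
    let ?f = "\<lambda>e. (norm (?A e))\<^sup>2"
    have hs: "(?f has_sum (norm A)\<^sup>2) hs_basis"
      by (rule norm_hs_op_has_sum[OF orthonormal_basis_hs_basis])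
    have r2: "r\<^sup>2 / 8 > 0" using that by simp
    have "\<forall>\<epsilon>>0. \<exists>F. finite F \<and> F \<subseteq> hs_basis \<and>
        (\<forall>Y. finite Y \<and> F \<subseteq> Y \<and> Y \<subseteq> hs_basis \<longrightarrow> dist (sum ?f Y) ((norm A)\<^sup>2) < \<epsilon>)"
      using hs unfolding has_sum_def tendsto_iff eventually_finite_subsets_at_top .
    from this[THEN spec, THEN mp, OF r2] obtain F where F': "finite F \<and> F \<subseteq> hs_basis \<and>
        (\<forall>Y. finite Y \<and> F \<subseteq> Y \<and> Y \<subseteq> hs_basis \<longrightarrow> dist (sum ?f Y) ((norm A)\<^sup>2) < r\<^sup>2 / 8)" ..
    then have F: "finite F" "F \<subseteq> hs_basis" by simp_all
    have FY: "dist (sum ?f Y) ((norm A)\<^sup>2) < r\<^sup>2 / 8"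
      if "finite Y" "F \<subseteq> Y" "Y \<subseteq> hs_basis" for Y
      using conjunct2[OF conjunct2[OF F']] that by simp
    define c where "c = real (card F + 1)"
    define \<delta> where "\<delta> = r / (2 * sqrt c)"
    have "c > 0" by (simp add: c_def)
    have "\<delta> > 0" using that \<open>c > 0\<close> by (simp add: \<delta>_def)
    have \<delta>2: "\<delta>\<^sup>2 = r\<^sup>2 / (4 * c)"
      using \<open>c > 0\<close> by (simp add: \<delta>_def power_divide power_mult_distrib)
    have "\<exists>d\<in>D. dist d (?A e) < \<delta>" for e
    proof -
      have "\<exists>d\<in>D. d \<in> ball (?A e) \<delta>"
        by (rule D(2)) (use \<open>\<delta> > 0\<close> in auto)
      then show ?thesis by (simp add: dist_commute)
    qed
    then obtain d where d: "\<And>e. d e \<in> D" "\<And>e. dist (d e) (?A e) < \<delta>" by metis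
    define q where "q = op (F, restrict d F)"
    have "(F, restrict d F) \<in> I" using F d(1) by (auto simp: I_def)
    then have "q \<in> Q" by (simp add: Q_def q_def)
    moreover have "norm (q - A) \<le> sqrt (r\<^sup>2 / 2)"
    proof (rule norm_hs_op_le)
      fix G :: "'a set" assume G: "finite G" "G \<subseteq> hs_basis"
      let ?g = "\<lambda>e. (norm (blinfun_apply (hs_blinfun (q - A)) e))\<^sup>2"
      have g: "?g e = (if e \<in> F then (dist (d e) (?A e))\<^sup>2 else ?f e)" if "e \<in> hs_basis" for e
        using op[OF F that] by (simp add: q_def minus_hs_op.rep_eq blinfun.diff_left dist_norm)
      have "sum ?g G \<le> sum ?g (G \<union> F)" using G F by (intro sum_mono2) auto
      also have "\<dots> = sum ?g F + sum ?g (G - F)"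
        using sum.union_disjoint[of F "G - F" ?g] G F by (simp add: Un_commute)
      also have "sum ?g F \<le> (\<Sum>e\<in>F. \<delta>\<^sup>2)"
      proof (rule sum_mono)
        fix e assume "e \<in> F"
        then have "e \<in> hs_basis" using F by blast
        then have "?g e = (dist (d e) (?A e))\<^sup>2" using g[of e] \<open>e \<in> F\<close> by (simp only: if_True)
        also have "\<dots> \<le> \<delta>\<^sup>2"
          using d(2)[of e] by (intro power_mono) auto
        finally show "?g e \<le> \<delta>\<^sup>2" .
      qed
      also have "(\<Sum>e\<in>F. \<delta>\<^sup>2) \<le> c * \<delta>\<^sup>2"
        by (simp add: c_def distrib_right)
      also have "c * \<delta>\<^sup>2 = r\<^sup>2 / 4"
        using \<open>c > 0\<close> by (simp add: \<delta>2)
      also have "sum ?g (G - F) = sum ?f (G - F)"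
      proof (rule sum.cong)
        fix e assume e: "e \<in> G - F"
        then have "e \<in> hs_basis" "e \<notin> F" using G by blast+
        then show "?g e = ?f e" using g[of e] by (simp only: if_False)
      qed simp
      also have "sum ?f (G - F) = sum ?f (G \<union> F) - sum ?f F"
        using sum.union_disjoint[of F "G - F" ?f] G F by (simp add: Un_commute)
      also have "\<dots> \<le> r\<^sup>2 / 4"
      proof -
        have "dist (sum ?f F) ((norm A)\<^sup>2) < r\<^sup>2 / 8" by (rule FY) (use F in auto)
        moreover have "dist (sum ?f (G \<union> F)) ((norm A)\<^sup>2) < r\<^sup>2 / 8" by (rule FY) (use F G in auto)
        ultimately show ?thesis unfolding dist_real_def by linarith
      qed
      finally show "sum ?g G \<le> (sqrt (r\<^sup>2 / 2))\<^sup>2" by simp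
    qed simp
    moreover have "sqrt (r\<^sup>2 / 2) < r"
      using that by (intro real_less_lsqrt) (auto simp: field_simps)
    ultimately show ?thesis by (intro bexI[of _ q]) (simp_all add: dist_norm)
  qed
  let ?\<B> = "(\<lambda>(q, r). ball q (real_of_rat r)) ` (Q \<times> UNIV)"
  have "topological_basis ?\<B>"
  proof (rule topological_basisI)
    fix U :: "'a hs_op set" and A assume "open U" "A \<in> U"
    then obtain r where r: "r > 0" "ball A r \<subseteq> U" unfolding open_contains_ball by blast
    obtain s where s: "0 < real_of_rat s" "real_of_rat s < r / 2"
      using of_rat_dense[of 0 "r/2"] r(1) by auto
    obtain q where q: "q \<in> Q" "dist q A < real_of_rat s" using dense[OF s(1)] by blast
    have "ball q (real_of_rat s) \<subseteq> ball A r"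
    proof
      fix B assume "B \<in> ball q (real_of_rat s)"
      then have "dist B q < real_of_rat s" by (simp add: dist_commute)
      then show "B \<in> ball A r"
        using q(2) s(2) dist_triangle2[of A B q] by (simp add: dist_commute)
    qed
    then show "\<exists>B'\<in>?\<B>. A \<in> B' \<and> B' \<subseteq> U"
      using q r(2)
      by (intro bexI[of _ "ball q (real_of_rat s)"] conjI image_eqI[of _ _ "(q, s)"])
        (auto simp: dist_commute)
  qed auto
  moreover have "countable ?\<B>" using cQ by auto
  ultimately show "\<exists>B :: 'a hs_op set set. countable B \<and> open = generate_topology B"
    using topological_basis_imp_subbasis by blast
qed

definition cadlag :: "(real \<Rightarrow> 'a::topological_space) \<Rightarrow> bool" where
  "cadlag f \<longleftrightarrow>
     (\<forall>t\<ge>0. (f \<longlongrightarrow> f t) (at_right t) \<and> (\<exists>l. (f \<longlongrightarrow> l) (at t within {0..<t})))"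

(* Increments are taken in int because subtraction on nat truncates. *)
definition poisson_process :: "'w measure \<Rightarrow> real \<Rightarrow> (real \<Rightarrow> 'w \<Rightarrow> nat) \<Rightarrow> bool" where
  "poisson_process M l N \<longleftrightarrow>
     (\<forall>t\<ge>0. N t \<in> measurable M (count_space UNIV)) \<and>
     (AE \<omega> in M. N 0 \<omega> = 0) \<and>
     (\<forall>(n::nat) t. 0 \<le> t 0 \<and> (\<forall>i<n. t i \<le> t (Suc i)) \<longrightarrow>
        prob_space.indep_vars M (\<lambda>_. count_space UNIV)
          (\<lambda>i \<omega>. int (N (t (Suc i)) \<omega>) - int (N (t i) \<omega>)) {..<n}) \<and>
     (\<forall>s t k. 0 \<le> s \<and> s < t \<longrightarrow>
        measure M {\<omega> \<in> space M. int (N t \<omega>) - int (N s \<omega>) = int k} =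
          exp (- (l * (t - s))) * (l * (t - s)) ^ k / fact k) \<and>
     (AE \<omega> in M. cadlag (\<lambda>t. N t \<omega>))"

(* Sequences of jumps are indexed by i = 1, 2, ...; the entry at 0 is irrelevant. *)
definition iid_seq :: "'w measure \<Rightarrow> (nat \<Rightarrow> 'w \<Rightarrow> 'b::topological_space) \<Rightarrow> bool" where
  "iid_seq M X \<longleftrightarrow>
     prob_space.indep_vars M (\<lambda>_. borel) X {1..} \<and>
     (\<forall>i\<ge>1. distr M borel (X i) = distr M borel (X 1))"

(* The sigma-algebras generated by the whole process and by the whole sequence are independent. *)
definition indep_process_seq ::
    "'w measure \<Rightarrow> (real \<Rightarrow> 'w \<Rightarrow> nat) \<Rightarrow> (nat \<Rightarrow> 'w \<Rightarrow> 'b::topological_space) \<Rightarrow> bool" where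
  "indep_process_seq M N X \<longleftrightarrow>
     prob_space.indep_set M
       (sigma_sets (space M) {N t -` A \<inter> space M | t A. 0 \<le> t})
       (sigma_sets (space M) {X i -` B \<inter> space M | i B. 1 \<le> i \<and> B \<in> sets borel})"

definition jump_sum ::
    "(real \<Rightarrow> 'w \<Rightarrow> nat) \<Rightarrow> (nat \<Rightarrow> 'w \<Rightarrow> 'b::comm_monoid_add) \<Rightarrow> real \<Rightarrow> 'w \<Rightarrow> 'b" where
  "jump_sum N X t \<omega> = (\<Sum>i=1..N t \<omega>. X i \<omega>)"

definition compound_poisson_process ::
    "'w measure \<Rightarrow> real \<Rightarrow> (real \<Rightarrow> 'w \<Rightarrow> 'b::real_normed_vector) \<Rightarrow> bool" where
  "compound_poisson_process M l L \<longleftrightarrow>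
     (\<exists>N X. poisson_process M l N \<and> iid_seq M X \<and> indep_process_seq M N X \<and>
        (\<forall>t\<ge>0. \<forall>\<omega>\<in>space M. L t \<omega> = jump_sum N X t \<omega>))"

definition square_integrable_process ::
    "'w measure \<Rightarrow> (real \<Rightarrow> 'w \<Rightarrow> 'b::real_normed_vector) \<Rightarrow> bool" where
  "square_integrable_process M L \<longleftrightarrow>
     (\<forall>t\<ge>0. L t \<in> borel_measurable M \<and> integrable M (\<lambda>\<omega>. (norm (L t \<omega>))\<^sup>2))"

(* The equation dV(t) = C V(t) dt + dL(t), V(0) = V0, in integrated form:
   V(t) = V0 + (integral of C V(s) over s in [0, t]) + L(t) - L(0) for all t \<ge> 0, almost surely.
   The has_integral clause includes the existence of the integral, and t = 0 gives V(0) = V0. *)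
definition linear_sde_solution ::
    "'w measure \<Rightarrow> ('b \<Rightarrow>\<^sub>L 'b) \<Rightarrow> (real \<Rightarrow> 'w \<Rightarrow> 'b::real_normed_vector) \<Rightarrow> ('w \<Rightarrow> 'b) \<Rightarrow>
       (real \<Rightarrow> 'w \<Rightarrow> 'b) \<Rightarrow> bool" where
  "linear_sde_solution M C L V0 V \<longleftrightarrow>
     (\<forall>t\<ge>0. V t \<in> borel_measurable M) \<and>
     (AE \<omega> in M. \<forall>t\<ge>0.
        ((\<lambda>s. blinfun_apply C (V s \<omega>)) has_integral
           (V t \<omega> - V0 \<omega> - (L t \<omega> - L 0 \<omega>))) {0..t})"

end

theory Submission
  imports Defs
begin

text \<open>
  Both equations have the same drift \<open>C\<close> and their jumps occur at the same times. The difference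
  \<open>D = V - V'\<close> of two solutions therefore solves
  \<open>D t = D 0 + \<integral>\<^sub>0\<^sup>t C (D s) ds + (\<Sum>i\<le>N(t). X i - X' i)\<close>,
  an equation that can be estimated path by path.

  The path of \<open>N\<close> is almost surely monotone, so on \<open>[0, T]\<close> the inhomogeneous part of the equation
  is bounded by \<open>|D(0)| + S\<close> with \<open>S = \<Sum>i\<le>N(T). |X i - X' i|\<close>, and Gronwall's inequality gives
  \<open>|D(t)| \<le> (|D(0)| + S) * exp (T * |C|)\<close> for all \<open>t \<le> T\<close> at once. This is lemma
  \<open>linear_sde_solution_diff_bound_AE\<close>. The supremum over \<open>t\<close> is thus
  dominated by a single random variable. Squaring the sum of two terms costs the factor 2.

  It remains to bound the second moment of the random sum \<open>S\<close>. By Cauchy-Schwarz,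
  \<open>S\<^sup>2 \<le> N(T) * (\<Sum>i\<le>N(T). |X i - X' i|\<^sup>2)\<close>. Since \<open>N\<close> is independent of the jumps and the
  differences \<open>X i - X' i\<close> all have the same law, conditioning on \<open>N(T) = k\<close> turns the expectation
  of the right-hand side into
  \<open>E[N(T)\<^sup>2] * E|X 1 - X' 1|\<^sup>2\<close>, and the second moment of a Poisson variable with mean \<open>l * T\<close> is
  \<open>l * T * (1 + l * T)\<close>. This is lemma \<open>poisson_random_sum_second_moment\<close>; applied to the jumps
  themselves instead of their differences it also yields square integrability of the compound
  Poisson processes. The jump term obtained in this way carries the factor \<open>exp (2 * T * |C|)\<close> only
  once; it occurs twice in \<open>C\<^sub>1(T)\<close>, and the bound is weakened to that form by \<open>exp (2 * T * |C|) \<ge> 1\<close>.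
\<close>

section \<open>A deterministic Gronwall bound\<close>

text \<open>
  The function \<open>(a + c * \<integral>\<^sub>0\<^sup>s u) * exp (- c * s)\<close> has a nonpositive derivative and starts at \<open>a\<close>.
\<close>
lemma gronwall_continuous:
  fixes u :: "real \<Rightarrow> real"
  assumes cont: "continuous_on {0..T} u" and c: "c \<ge> 0"
    and le: "\<And>t. t \<in> {0..T} \<Longrightarrow> u t \<le> a + c * integral {0..t} u"
    and t: "t \<in> {0..T}"
  shows "u t \<le> a * exp (c * t)"
proof -
  define G where "G s = (a + c * integral {0..s} u) * exp (- (c * s))" for s
  have "G t \<le> G 0"
  proof (rule DERIV_nonpos_imp_decreasing_open[of 0 t G])
    fix s assume s: "0 < s" "s < t"
    have "((\<lambda>s. integral {0..s} u) has_vector_derivative u s) (at s within {0..T})"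
      using integral_has_vector_derivative[OF cont, of s] s t by auto
    moreover have "at s within {0..T} = at s"
      using s t by (intro at_within_Icc_at) auto
    ultimately have I: "((\<lambda>s. integral {0..s} u) has_real_derivative u s) (at s)"
      by (simp add: has_real_derivative_iff_has_vector_derivative)
    have "(G has_real_derivative
        c * (u s - (a + c * integral {0..s} u)) * exp (- (c * s))) (at s)"
      unfolding G_def by (rule derivative_eq_intros I refl | simp add: algebra_simps)+
    moreover have "c * (u s - (a + c * integral {0..s} u)) * exp (- (c * s)) \<le> 0"
      using le[of s] s t c by (intro mult_nonpos_nonneg mult_nonneg_nonpos) auto
    ultimately show "\<exists>y. DERIV G s :> y \<and> y \<le> 0" by blast
  next
    have "u integrable_on {0..t}"
      using t by (intro integrable_continuous_real continuous_on_subset[OF cont]) auto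
    then show "continuous_on {0..t} G"
      unfolding G_def by (intro continuous_intros indefinite_integral_continuous_1)
  qed (use t in auto)
  then have "(a + c * integral {0..t} u) * exp (- (c * t)) \<le> a" by (simp add: G_def)
  then have "a + c * integral {0..t} u \<le> a * exp (c * t)"
    by (simp add: exp_minus field_simps)
  with le[OF t] show ?thesis by linarith
qed

text \<open>
  A solution \<open>D\<close> jumps, and its norm is not known in advance to be integrable, so Gronwall's
  inequality cannot be applied to \<open>norm (D t)\<close> directly. It is applied to \<open>a + norm (K t)\<close>
  instead, where \<open>K\<close> is the integral term: \<open>K\<close> is continuous as an indefinite integral, and
  \<open>D = J + K\<close> makes this function a majorant of \<open>norm (D t)\<close>.
\<close>
lemma linear_integral_equation_bound:
  fixes C :: "'b::banach \<Rightarrow>\<^sub>L 'b" and D J :: "real \<Rightarrow> 'b"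
  assumes eq: "\<And>t. t \<in> {0..T} \<Longrightarrow>
      ((\<lambda>s. blinfun_apply C (D s)) has_integral (D t - J t)) {0..t}"
    and J: "\<And>t. t \<in> {0..T} \<Longrightarrow> norm (J t) \<le> a"
    and t: "t \<in> {0..T}"
  shows "norm (D t) \<le> a * exp (norm C * T)"
proof -
  let ?f = "\<lambda>s. blinfun_apply C (D s)"
  define K where "K s = integral {0..s} ?f" for s
  define u where "u s = a + norm (K s)" for s
  have K: "D s = J s + K s" if "s \<in> {0..T}" for s
    using integral_unique[OF eq[OF that]] by (simp add: K_def)
  have f_int: "?f integrable_on {0..s}" if "s \<in> {0..T}" for s
    using eq[OF that] by (auto simp: integrable_on_def)
  have "T \<in> {0..T}" using t by simp
  then have cont: "continuous_on {0..T} u"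
    unfolding u_def K_def
    by (intro continuous_intros indefinite_integral_continuous_1 f_int)
  have Du: "norm (D s) \<le> u s" if "s \<in> {0..T}" for s
    using J[OF that] norm_triangle_ineq[of "J s" "K s"] by (simp add: K[OF that] u_def)
  have step: "u s \<le> a + norm C * integral {0..s} u" if s: "s \<in> {0..T}" for s
  proof -
    have "continuous_on {0..s} u" using s by (intro continuous_on_subset[OF cont]) auto
    then have "u integrable_on {0..s}" by (rule integrable_continuous_real)
    then have "(\<lambda>r. norm C * u r) integrable_on {0..s}"
      by (rule integrable_on_mult_right)
    moreover have "norm (?f r) \<le> norm C * u r" if "r \<in> {0..s}" for r
    proof -
      have "norm (?f r) \<le> norm C * norm (D r)" by (rule norm_blinfun)
      also have "\<dots> \<le> norm C * u r" using Du[of r] that s by (intro mult_left_mono) auto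
      finally show ?thesis .
    qed
    ultimately have "norm (K s) \<le> integral {0..s} (\<lambda>r. norm C * u r)"
      unfolding K_def by (intro integral_norm_bound_integral f_int s)
    then show ?thesis by (simp add: u_def[of s])
  qed
  have "0 \<le> a" using order_trans[OF norm_ge_zero J[OF t]] .
  have "u t \<le> a * exp (norm C * t)"
    by (rule gronwall_continuous[OF cont norm_ge_zero step t])
  also have "\<dots> \<le> a * exp (norm C * T)"
    using t \<open>0 \<le> a\<close> by (intro mult_left_mono) (auto intro: mult_left_mono)
  finally show ?thesis using Du[OF t] by linarith
qed

section \<open>Poisson processes\<close>

text \<open>
  Multiplying the terms of the exponential series by \<open>k\<close> amounts to a shift of the index and
  a factor \<open>a\<close>; doing this twice gives \<open>k\<^sup>2\<close>.
\<close>
lemma poisson_second_moment_sums: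
  "(\<lambda>k. (real k)\<^sup>2 * (exp (- a) * a ^ k / fact k)) sums (a + a\<^sup>2)"
proof -
  have e: "(\<lambda>k. a ^ k / fact k) sums exp a"
    using exp_converges[of a] by (simp add: divide_inverse mult.commute)
  have e1: "(\<lambda>k. real k * (a ^ k / fact k)) sums (a * exp a)"
  proof -
    have "(\<lambda>k. real (Suc k) * (a ^ Suc k / fact (Suc k))) = (\<lambda>k. a * (a ^ k / fact k))"
      by (auto simp: fun_eq_iff divide_simps)
    then have "(\<lambda>k. real (Suc k) * (a ^ Suc k / fact (Suc k))) sums (a * exp a)"
      using sums_mult[OF e, of a] by simp
    from sums_Suc[OF this] show ?thesis by simp
  qed
  have e2: "(\<lambda>k. (real k)\<^sup>2 * (a ^ k / fact k)) sums (a * (a * exp a + exp a))"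
  proof -
    have "(\<lambda>k. (real (Suc k))\<^sup>2 * (a ^ Suc k / fact (Suc k)))
        = (\<lambda>k. a * (real k * (a ^ k / fact k) + a ^ k / fact k))"
      by (auto simp: fun_eq_iff divide_simps power2_eq_square) (auto simp: algebra_simps)
    then have "(\<lambda>k. (real (Suc k))\<^sup>2 * (a ^ Suc k / fact (Suc k))) sums (a * (a * exp a + exp a))"
      using sums_mult[OF sums_add[OF e1 e], of a] by simp
    from sums_Suc[OF this] show ?thesis by simp
  qed
  have "exp (- a) * (a * (a * exp a + exp a)) = a + a\<^sup>2"
    by (simp add: exp_minus field_simps power2_eq_square)
  with sums_mult[OF e2, of "exp (- a)"] show ?thesis
    by (simp add: mult_ac)
qed

lemma (in prob_space) poisson_process_second_moment:
  assumes N: "poisson_process M l N" and l: "l > 0" and t: "t \<ge> 0"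
  shows "(\<integral>\<^sup>+\<omega>. ennreal ((real (N t \<omega>))\<^sup>2) \<partial>M) = ennreal (l * t + (l * t)\<^sup>2)"
proof (cases "t = 0")
  case True
  have "AE \<omega> in M. N 0 \<omega> = 0" using N by (simp add: poisson_process_def)
  then have "(\<integral>\<^sup>+\<omega>. ennreal ((real (N 0 \<omega>))\<^sup>2) \<partial>M) = (\<integral>\<^sup>+\<omega>. 0 \<partial>M)"
    by (intro nn_integral_cong_AE) auto
  then show ?thesis using True by simp
next
  case False
  with t have t: "t > 0" by simp
  have [measurable]: "N t \<in> measurable M (count_space UNIV)" "N 0 \<in> measurable M (count_space UNIV)"
    using N t by (auto simp: poisson_process_def)
  have law: "prob {\<omega> \<in> space M. N t \<omega> = k} = exp (- (l * t)) * (l * t) ^ k / fact k" for k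
  proof -
    have "AE \<omega> in M. N 0 \<omega> = 0" using N by (simp add: poisson_process_def)
    then have "prob {\<omega> \<in> space M. N t \<omega> = k}
        = prob {\<omega> \<in> space M. int (N t \<omega>) - int (N 0 \<omega>) = int k}"
      by (intro finite_measure_eq_AE) auto
    also have "\<dots> = exp (- (l * (t - 0))) * (l * (t - 0)) ^ k / fact k"
      using N t unfolding poisson_process_def by blast
    finally show ?thesis by simp
  qed
  have "(\<integral>\<^sup>+\<omega>. ennreal ((real (N t \<omega>))\<^sup>2) \<partial>M)
      = (\<integral>\<^sup>+k. ennreal ((real k)\<^sup>2) \<partial>distr M (count_space UNIV) (N t))"
    by (subst nn_integral_distr) auto
  \<comment> \<open>A measure on the natural numbers has its point masses as density for counting measure.\<close>
  also have "\<dots> = (\<integral>\<^sup>+k. ennreal ((real k)\<^sup>2) * emeasure (distr M (count_space UNIV) (N t)) {k} \<partial>count_space UNIV)"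
  proof -
    let ?D = "distr M (count_space UNIV) (N t)"
    have "?D = density (count_space UNIV) (\<lambda>k. emeasure ?D {k})"
      by (rule measure_eqI_countable[where A = UNIV]) (auto simp: emeasure_density)
    then show ?thesis
      by (subst (1) \<open>?D = _\<close>) (subst nn_integral_density, auto simp: mult.commute)
  qed
  also have "\<dots> = (\<Sum>k. ennreal ((real k)\<^sup>2 * (exp (- (l * t)) * (l * t) ^ k / fact k)))"
  proof -
    have "emeasure (distr M (count_space UNIV) (N t)) {k}
        = ennreal (exp (- (l * t)) * (l * t) ^ k / fact k)" for k
      unfolding law[symmetric] emeasure_eq_measure[symmetric]
      by (subst emeasure_distr) (auto intro!: arg_cong2[where f = emeasure])
    then show ?thesis
      by (simp add: nn_integral_count_space_nat flip: ennreal_mult')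
  qed
  also have "\<dots> = ennreal (l * t + (l * t)\<^sup>2)"
    using l t by (intro suminf_ennreal_eq poisson_second_moment_sums) auto
  finally show ?thesis .
qed

text \<open>
  The law of an increment is only prescribed on the natural numbers, but there its probabilities
  already sum to 1. A negative increment thus has probability 0.
\<close>
lemma (in prob_space) poisson_process_mono_pair_AE:
  assumes N: "poisson_process M l N" and st: "0 \<le> s" "s < t"
  shows "AE \<omega> in M. N s \<omega> \<le> N t \<omega>"
proof -
  have Nt[measurable]: "N t \<in> measurable M (count_space UNIV)"
    and Ns[measurable]: "N s \<in> measurable M (count_space UNIV)"
    using N st by (auto simp: poisson_process_def)
  have "{\<omega> \<in> space M. N s \<omega> \<le> N t \<omega>}
      = (\<Union>k. (N s -` {k} \<inter> space M) \<inter> (N t -` {k..} \<inter> space M))"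
    by auto
  also have "\<dots> \<in> events"
    by (intro sets.countable_UN image_subsetI sets.Int measurable_sets[OF Ns] measurable_sets[OF Nt]) auto
  finally have le_event: "{\<omega> \<in> space M. N s \<omega> \<le> N t \<omega>} \<in> events" .
  have "(\<lambda>k. prob {\<omega> \<in> space M. int (N t \<omega>) - int (N s \<omega>) = int k})
      sums prob {\<omega> \<in> space M. N s \<omega> \<le> N t \<omega>}"
  proof (rule prob_sums)
    show "AE \<omega> in M. (\<forall>k. int (N t \<omega>) - int (N s \<omega>) = int k \<longrightarrow> N s \<omega> \<le> N t \<omega>) \<and>
        (N s \<omega> \<le> N t \<omega> \<longrightarrow> (\<exists>!k. int (N t \<omega>) - int (N s \<omega>) = int k))"
      by (rule AE_I2) (auto intro: zero_le_imp_eq_int)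
    show "{\<omega> \<in> space M. N s \<omega> \<le> N t \<omega>} \<in> events" by (rule le_event)
  qed measurable
  moreover have "prob {\<omega> \<in> space M. int (N t \<omega>) - int (N s \<omega>) = int k}
      = exp (- (l * (t - s))) * ((l * (t - s)) ^ k / fact k)" for k
    using N st unfolding poisson_process_def by simp
  moreover have "(\<lambda>k. exp (- (l * (t - s))) * ((l * (t - s)) ^ k / fact k))
      sums (exp (- (l * (t - s))) * exp (l * (t - s)))"
    using exp_converges[of "l * (t - s)"]
    by (intro sums_mult) (simp add: divide_inverse mult.commute)
  ultimately have "prob {\<omega> \<in> space M. N s \<omega> \<le> N t \<omega>} = 1"
    by (simp add: sums_iff flip: exp_add)
  then show ?thesis using prob_Collect_eq_1[OF le_event] by simp
qed

text \<open>
  The exceptional null set of the previous lemma depends on the times. Rational times \<open>s\<close> give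
  countably many null sets, and right-continuity carries the inequality over to all \<open>s\<close>: the
  values are natural numbers, so a path is constant on a short interval to the right of \<open>s\<close>, and
  that interval contains a rational time.
\<close>
lemma (in prob_space) poisson_process_le_endpoint_AE:
  assumes N: "poisson_process M l N"
  shows "AE \<omega> in M. \<forall>s\<in>{0..T}. N s \<omega> \<le> N T \<omega>"
proof -
  have "AE \<omega> in M. \<forall>q\<in>{0..<T} \<inter> \<rat>. N q \<omega> \<le> N T \<omega>"
    by (subst AE_ball_countable)
      (auto intro!: poisson_process_mono_pair_AE[OF N] countable_Int2 countable_rat)
  moreover have "AE \<omega> in M. cadlag (\<lambda>t. N t \<omega>)" using N by (simp add: poisson_process_def)
  ultimately show ?thesis
  proof eventually_elim
    case (elim \<omega>)
    show ?case
    proof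
      fix s assume s: "s \<in> {0..T}"
      show "N s \<omega> \<le> N T \<omega>"
      proof (cases "s = T")
        case False
        have "((\<lambda>t. N t \<omega>) \<longlongrightarrow> N s \<omega>) (at_right s)"
          using elim(2) s by (auto simp: cadlag_def)
        then have "\<forall>\<^sub>F q in at_right s. N q \<omega> = N s \<omega>"
          by (simp add: tendsto_discrete)
        then obtain b where b: "b > s" "\<And>q. s < q \<Longrightarrow> q < b \<Longrightarrow> N q \<omega> = N s \<omega>"
          unfolding eventually_at_right_field by blast
        obtain q where q: "q \<in> \<rat>" "s < q" "q < min b T"
          using Rats_dense_in_real[of s "min b T"] b(1) s False by auto
        then have "q \<in> {0..<T} \<inter> \<rat>" using s by auto
        then have "N q \<omega> \<le> N T \<omega>" using elim(1) by blast
        then show ?thesis using b(2) q by simp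
      qed simp
    qed
  qed
qed

section \<open>Random sums\<close>

lemma (in prob_space) indep_process_seq_compose:
  fixes Y :: "nat \<Rightarrow> 'a \<Rightarrow> 'b::topological_space" and f :: "'b \<Rightarrow> 'c::topological_space"
  assumes "indep_process_seq M N Y" and f: "f \<in> borel_measurable borel"
  shows "indep_process_seq M N (\<lambda>i \<omega>. f (Y i \<omega>))"
proof -
  have "{(\<lambda>\<omega>. f (Y i \<omega>)) -` B \<inter> space M | i B. 1 \<le> i \<and> B \<in> sets borel}
      \<subseteq> {Y i -` B \<inter> space M | i B. 1 \<le> i \<and> B \<in> sets borel}"
  proof safe
    fix i :: nat and B :: "'c set" assume *: "1 \<le> i" "B \<in> sets borel"
    show "\<exists>i' B'. (\<lambda>\<omega>. f (Y i \<omega>)) -` B \<inter> space M = Y i' -` B' \<inter> space M \<and> 1 \<le> i' \<and> B' \<in> sets borel"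
      using * measurable_sets[OF f, of B]
      by (intro exI[of _ i] exI[of _ "f -` B"]) auto
  qed
  then have "sigma_sets (space M) {(\<lambda>\<omega>. f (Y i \<omega>)) -` B \<inter> space M | i B. 1 \<le> i \<and> B \<in> sets borel}
      \<subseteq> sigma_sets (space M) {Y i -` B \<inter> space M | i B. 1 \<le> i \<and> B \<in> sets borel}"
    by (rule sigma_sets_mono')
  with assms(1) show ?thesis
    unfolding indep_process_seq_def indep_set_def
    by (elim indep_sets_mono_sets) (auto split: bool.splits)
qed

text \<open>
  The constant \<open>indep_var\<close> relates variables with values in one common type. Events about \<open>N t\<close>
  are therefore represented by their \<open>ennreal\<close>-valued indicators.
\<close>
lemma (in prob_space) indep_process_seq_imp_indep_var_indicator:
  fixes W :: "nat \<Rightarrow> 'a \<Rightarrow> ennreal"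
  assumes ind: "indep_process_seq M N W" and t: "t \<ge> 0" and i: "i \<ge> 1"
    and N: "N t \<in> measurable M (count_space UNIV)" and W: "W i \<in> borel_measurable M"
  shows "indep_var borel (\<lambda>\<omega>. indicator A (N t \<omega>)) borel (W i)"
proof -
  let ?I = "\<lambda>\<omega>. indicator A (N t \<omega>) :: ennreal"
  have "{?I -` B \<inter> space M | B. B \<in> sets borel} \<subseteq> {N t -` A \<inter> space M | t A. 0 \<le> t}"
  proof safe
    fix B :: "ennreal set"
    show "\<exists>t' A'. ?I -` B \<inter> space M = N t' -` A' \<inter> space M \<and> 0 \<le> t'"
      using t by (intro exI[of _ t] exI[of _ "indicator A -` B"]) auto
  qed
  then have "sigma_sets (space M) {?I -` B \<inter> space M | B. B \<in> sets borel}
      \<subseteq> sigma_sets (space M) {N t -` A \<inter> space M | t A. 0 \<le> t}"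
    by (rule sigma_sets_mono')
  moreover have "sigma_sets (space M) {W i -` B \<inter> space M | B. B \<in> sets borel}
      \<subseteq> sigma_sets (space M) {W i -` B \<inter> space M | i B. 1 \<le> i \<and> B \<in> sets borel}"
    using i by (intro sigma_sets_mono') auto
  ultimately have "indep_set (sigma_sets (space M) {?I -` B \<inter> space M | B. B \<in> sets borel})
      (sigma_sets (space M) {W i -` B \<inter> space M | B. B \<in> sets borel})"
    using ind unfolding indep_process_seq_def indep_set_def
    by (elim indep_sets_mono_sets) (auto split: bool.splits)
  moreover have "?I \<in> borel_measurable M" by (rule measurable_compose[OF N]) simp
  ultimately show ?thesis unfolding indep_var_eq using W by blast
qed

lemma (in prob_space) indep_var_nn_integral_mult:
  fixes U W :: "'a \<Rightarrow> ennreal"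
  assumes "indep_var borel U borel W"
  shows "(\<integral>\<^sup>+\<omega>. U \<omega> * W \<omega> \<partial>M) = (\<integral>\<^sup>+\<omega>. U \<omega> \<partial>M) * (\<integral>\<^sup>+\<omega>. W \<omega> \<partial>M)"
proof -
  have "case_bool borel borel = (\<lambda>_. borel :: ennreal measure)"
    by (auto split: bool.split)
  with assms have "indep_vars (\<lambda>_. borel) (case_bool U W) UNIV"
    unfolding indep_var_def by simp
  from indep_vars_nn_integral[OF _ this] show ?thesis
    by (simp add: UNIV_bool mult.commute)
qed

text \<open>
  On the event \<open>K = k\<close> the integrand is \<open>k\<close> times a sum of \<open>k\<close> variables that are independent of
  this event and have mean \<open>m\<close>. Summing over \<open>k\<close> the contributions \<open>k\<^sup>2 * P(K = k) * m\<close> gives the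
  second moment of \<open>K\<close>.
\<close>
lemma (in prob_space) random_sum_nn_integral:
  fixes W :: "nat \<Rightarrow> 'a \<Rightarrow> ennreal"
  assumes K[measurable]: "K \<in> measurable M (count_space UNIV)"
    and ind: "\<And>i k. i \<ge> 1 \<Longrightarrow> indep_var borel (\<lambda>\<omega>. indicator {k} (K \<omega>)) borel (W i)"
    and mean: "\<And>i. i \<ge> 1 \<Longrightarrow> (\<integral>\<^sup>+\<omega>. W i \<omega> \<partial>M) = m"
  shows "(\<integral>\<^sup>+\<omega>. ennreal (real (K \<omega>)) * (\<Sum>i=1..K \<omega>. W i \<omega>) \<partial>M)
    = (\<integral>\<^sup>+\<omega>. ennreal ((real (K \<omega>))\<^sup>2) \<partial>M) * m"
proof -
  let ?I = "\<lambda>k \<omega>. indicator {k} (K \<omega>) :: ennreal"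
  have [measurable]: "?I k \<in> borel_measurable M" for k
    by (rule measurable_compose[OF K]) simp
  have W: "W i \<in> borel_measurable M" if "i \<ge> 1" for i
    using ind[OF that] by (simp add: indep_var_eq)
  have [measurable]: "(\<lambda>\<omega>. \<Sum>i=1..k. W i \<omega>) \<in> borel_measurable M" for k
    by (intro borel_measurable_sum W) auto
  have split: "f (K \<omega>) = (\<Sum>k. ?I k \<omega> * f k)" for f :: "nat \<Rightarrow> ennreal" and \<omega>
    using suminf_finite[of "{K \<omega>}" "\<lambda>k. ?I k \<omega> * f k"] by (auto simp: indicator_def)
  have "(\<integral>\<^sup>+\<omega>. ennreal (real (K \<omega>)) * (\<Sum>i=1..K \<omega>. W i \<omega>) \<partial>M)
      = (\<integral>\<^sup>+\<omega>. (\<Sum>k. ?I k \<omega> * (ennreal (real k) * (\<Sum>i=1..k. W i \<omega>))) \<partial>M)"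
    by (subst split) (rule refl)
  also have "\<dots> = (\<Sum>k. \<integral>\<^sup>+\<omega>. ?I k \<omega> * (ennreal (real k) * (\<Sum>i=1..k. W i \<omega>)) \<partial>M)"
    by (intro nn_integral_suminf) measurable
  also have "\<dots> = (\<Sum>k. (\<integral>\<^sup>+\<omega>. ?I k \<omega> * ennreal ((real k)\<^sup>2) \<partial>M) * m)"
  proof (rule suminf_cong)
    fix k
    have "(\<integral>\<^sup>+\<omega>. ?I k \<omega> * (ennreal (real k) * (\<Sum>i=1..k. W i \<omega>)) \<partial>M)
        = (\<integral>\<^sup>+\<omega>. ennreal (real k) * (\<Sum>i=1..k. ?I k \<omega> * W i \<omega>) \<partial>M)"
      by (intro nn_integral_cong) (simp only: sum_distrib_left mult.left_commute)
    also have "\<dots> = ennreal (real k) * (\<Sum>i=1..k. \<integral>\<^sup>+\<omega>. ?I k \<omega> * W i \<omega> \<partial>M)"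
    proof -
      have "(\<lambda>\<omega>. ?I k \<omega> * W i \<omega>) \<in> borel_measurable M" if "i \<in> {1..k}" for i
        using W[of i] that by (intro borel_measurable_times_ennreal) auto
      then show ?thesis
        by (subst nn_integral_cmult, intro borel_measurable_sum, blast) (subst nn_integral_sum, blast+)
    qed
    also have "(\<Sum>i=1..k. \<integral>\<^sup>+\<omega>. ?I k \<omega> * W i \<omega> \<partial>M) = (\<Sum>i=1..k. (\<integral>\<^sup>+\<omega>. ?I k \<omega> \<partial>M) * m)"
      by (intro sum.cong refl) (simp add: indep_var_nn_integral_mult[OF ind] mean)
    also have "ennreal (real k) * \<dots> = (\<integral>\<^sup>+\<omega>. ?I k \<omega> * ennreal ((real k)\<^sup>2) \<partial>M) * m"
      by (subst nn_integral_multc, measurable)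
        (simp add: power2_eq_square ennreal_mult' mult_ac flip: ennreal_of_nat_eq_real_of_nat)
    finally show "(\<integral>\<^sup>+\<omega>. ?I k \<omega> * (ennreal (real k) * (\<Sum>i=1..k. W i \<omega>)) \<partial>M) =
      (\<integral>\<^sup>+\<omega>. ?I k \<omega> * ennreal ((real k)\<^sup>2) \<partial>M) * m" .
  qed
  also have "\<dots> = (\<integral>\<^sup>+\<omega>. (\<Sum>k. ?I k \<omega> * ennreal ((real k)\<^sup>2)) \<partial>M) * m"
    by (subst nn_integral_suminf) (auto intro!: borel_measurable_times_ennreal)
  also have "\<dots> = (\<integral>\<^sup>+\<omega>. ennreal ((real (K \<omega>))\<^sup>2) \<partial>M) * m"
    by (subst split[symmetric]) (rule refl)
  finally show ?thesis .
qed

text \<open>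
  By Cauchy-Schwarz the square of a sum of \<open>N t\<close> terms is at most \<open>N t\<close> times the sum of the
  squares, which is the form treated by \<open>random_sum_nn_integral\<close>.
\<close>
lemma (in prob_space) poisson_random_sum_second_moment:
  fixes Y :: "nat \<Rightarrow> 'a \<Rightarrow> 'b::real_normed_vector"
  assumes N: "poisson_process M l N" and l: "l > 0" and t: "t \<ge> 0"
    and ind: "indep_process_seq M N Y"
    and meas: "\<And>i. i \<ge> 1 \<Longrightarrow> Y i \<in> borel_measurable M"
    and law: "\<And>i. i \<ge> 1 \<Longrightarrow> distr M borel (Y i) = distr M borel (Y 1)"
  shows "(\<integral>\<^sup>+\<omega>. ennreal ((\<Sum>i=1..N t \<omega>. norm (Y i \<omega>))\<^sup>2) \<partial>M)
    \<le> ennreal (l * t * (1 + l * t)) * (\<integral>\<^sup>+\<omega>. ennreal ((norm (Y 1 \<omega>))\<^sup>2) \<partial>M)"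
proof -
  let ?W = "\<lambda>i \<omega>. ennreal ((norm (Y i \<omega>))\<^sup>2)"
  have K: "N t \<in> measurable M (count_space UNIV)" using N t by (simp add: poisson_process_def)
  have "indep_process_seq M N ?W"
    by (rule indep_process_seq_compose[OF ind]) measurable
  then have iW: "indep_var borel (\<lambda>\<omega>. indicator {k} (N t \<omega>)) borel (?W i)" if "i \<ge> 1" for i k
    using that t K meas[OF that] by (intro indep_process_seq_imp_indep_var_indicator) auto
  have mean: "(\<integral>\<^sup>+\<omega>. ?W i \<omega> \<partial>M) = (\<integral>\<^sup>+\<omega>. ?W 1 \<omega> \<partial>M)" if "i \<ge> 1" for i
  proof -
    have "(\<integral>\<^sup>+\<omega>. ?W i \<omega> \<partial>M) = (\<integral>\<^sup>+y. ennreal ((norm y)\<^sup>2) \<partial>distr M borel (Y i))"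
      using meas[OF that] by (subst nn_integral_distr) auto
    also have "\<dots> = (\<integral>\<^sup>+\<omega>. ?W 1 \<omega> \<partial>M)"
      unfolding law[OF that] using meas[of 1] by (subst nn_integral_distr) auto
    finally show ?thesis .
  qed
  have "(\<integral>\<^sup>+\<omega>. ennreal ((\<Sum>i=1..N t \<omega>. norm (Y i \<omega>))\<^sup>2) \<partial>M)
      \<le> (\<integral>\<^sup>+\<omega>. ennreal (real (N t \<omega>)) * (\<Sum>i=1..N t \<omega>. ?W i \<omega>) \<partial>M)"
  proof (rule nn_integral_mono)
    fix \<omega>
    have "ennreal ((\<Sum>i=1..N t \<omega>. norm (Y i \<omega>))\<^sup>2)
        \<le> ennreal (real (N t \<omega>) * (\<Sum>i=1..N t \<omega>. (norm (Y i \<omega>))\<^sup>2))"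
      using sum_squared_le_sum_of_squares[of "\<lambda>i. norm (Y i \<omega>)" "{1..N t \<omega>}"]
      by (intro ennreal_leI) (simp add: mult.commute)
    also have "\<dots> = ennreal (real (N t \<omega>)) * (\<Sum>i=1..N t \<omega>. ?W i \<omega>)"
      by (subst ennreal_mult) (auto intro!: sum_nonneg)
    finally show "ennreal ((\<Sum>i=1..N t \<omega>. norm (Y i \<omega>))\<^sup>2)
      \<le> ennreal (real (N t \<omega>)) * (\<Sum>i=1..N t \<omega>. ?W i \<omega>)" .
  qed
  also have "\<dots> = (\<integral>\<^sup>+\<omega>. ennreal ((real (N t \<omega>))\<^sup>2) \<partial>M) * (\<integral>\<^sup>+\<omega>. ?W 1 \<omega> \<partial>M)"
    by (rule random_sum_nn_integral[OF K iW mean])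
  also have "\<dots> = ennreal (l * t * (1 + l * t)) * (\<integral>\<^sup>+\<omega>. ?W 1 \<omega> \<partial>M)"
    unfolding poisson_process_second_moment[OF N l t]
    by (simp add: power2_eq_square distrib_left)
  finally show ?thesis .
qed

section \<open>Compound Poisson processes and linear equations driven by them\<close>

lemma measurable_jump_sum:
  fixes Y :: "nat \<Rightarrow> 'w \<Rightarrow> 'b::{real_normed_vector, second_countable_topology}"
  assumes N: "N t \<in> measurable M (count_space UNIV)"
    and Y: "\<And>i. i \<ge> 1 \<Longrightarrow> Y i \<in> borel_measurable M"
  shows "jump_sum N Y t \<in> borel_measurable M"
  unfolding jump_sum_def
  by (rule measurable_compose_countable[OF _ N]) (auto intro!: borel_measurable_sum Y)

lemma (in prob_space) jump_sum_square_integrable: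
  fixes Y :: "nat \<Rightarrow> 'a \<Rightarrow> 'b::{real_normed_vector, second_countable_topology}"
  assumes N: "poisson_process M l N" and l: "l > 0"
    and ind: "indep_process_seq M N Y"
    and iid: "iid_seq M Y"
    and sq: "integrable M (\<lambda>\<omega>. (norm (Y 1 \<omega>))\<^sup>2)"
  shows "square_integrable_process M (jump_sum N Y)"
  unfolding square_integrable_process_def
proof (intro allI impI conjI)
  fix t :: real assume t: "0 \<le> t"
  have Y: "Y i \<in> borel_measurable M" if "i \<ge> 1" for i
    using iid that by (auto simp: iid_seq_def indep_vars_def)
  have law: "distr M borel (Y i) = distr M borel (Y 1)" if "i \<ge> 1" for i
    using iid that unfolding iid_seq_def by blast
  have "N t \<in> measurable M (count_space UNIV)" using N t by (simp add: poisson_process_def)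
  then show meas: "jump_sum N Y t \<in> borel_measurable M"
    using Y by (rule measurable_jump_sum)
  show "integrable M (\<lambda>\<omega>. (norm (jump_sum N Y t \<omega>))\<^sup>2)"
  proof (rule integrableI_bounded)
    have "(\<integral>\<^sup>+\<omega>. ennreal (norm ((norm (jump_sum N Y t \<omega>))\<^sup>2)) \<partial>M)
        \<le> (\<integral>\<^sup>+\<omega>. ennreal ((\<Sum>i=1..N t \<omega>. norm (Y i \<omega>))\<^sup>2) \<partial>M)"
      by (intro nn_integral_mono ennreal_leI)
        (auto simp: jump_sum_def intro!: power_mono norm_sum)
    also have "\<dots> \<le> ennreal (l * t * (1 + l * t)) * (\<integral>\<^sup>+\<omega>. ennreal ((norm (Y 1 \<omega>))\<^sup>2) \<partial>M)"
      by (rule poisson_random_sum_second_moment[OF N l t ind Y law])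
    also have "\<dots> < \<infinity>"
      using sq by (auto simp: integrable_iff_bounded ennreal_mult_less_top)
    finally show "(\<integral>\<^sup>+\<omega>. ennreal (norm ((norm (jump_sum N Y t \<omega>))\<^sup>2)) \<partial>M) < \<infinity>" .
  qed (use meas in measurable)
qed

text \<open>
  The jumps that occur up to time \<open>t\<close> are among those up to time \<open>T\<close>, so the inhomogeneous part of
  the equation for the difference is bounded uniformly in \<open>t\<close>, as Gronwall's inequality requires.
\<close>
lemma (in prob_space) linear_sde_solution_diff_bound_AE:
  fixes C :: "'b::banach \<Rightarrow>\<^sub>L 'b"
  assumes N: "poisson_process M l N"
    and V: "linear_sde_solution M C (jump_sum N X) V0 V"
    and V': "linear_sde_solution M C (jump_sum N X') V0' V'"
  shows "AE \<omega> in M. \<forall>t\<in>{0..T}. norm (V t \<omega> - V' t \<omega>) \<le>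
    (norm (V0 \<omega> - V0' \<omega>) + (\<Sum>i=1..N T \<omega>. norm (X i \<omega> - X' i \<omega>))) * exp (norm C * T)"
proof -
  have "AE \<omega> in M. N 0 \<omega> = 0" using N by (simp add: poisson_process_def)
  moreover note poisson_process_le_endpoint_AE[OF N, of T]
  moreover have "AE \<omega> in M. \<forall>t\<ge>0. ((\<lambda>s. blinfun_apply C (V s \<omega>)) has_integral
      (V t \<omega> - V0 \<omega> - (jump_sum N X t \<omega> - jump_sum N X 0 \<omega>))) {0..t}"
    using V by (simp add: linear_sde_solution_def)
  moreover have "AE \<omega> in M. \<forall>t\<ge>0. ((\<lambda>s. blinfun_apply C (V' s \<omega>)) has_integral
      (V' t \<omega> - V0' \<omega> - (jump_sum N X' t \<omega> - jump_sum N X' 0 \<omega>))) {0..t}"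
    using V' by (simp add: linear_sde_solution_def)
  ultimately show ?thesis
  proof eventually_elim
    case (elim \<omega>)
    \<comment> \<open>\<open>N 0 \<omega> = 0\<close> makes the initial values of both jump sums vanish.\<close>
    define J where "J t = (V0 \<omega> - V0' \<omega>) + (\<Sum>i=1..N t \<omega>. X i \<omega> - X' i \<omega>)" for t
    define a where "a = norm (V0 \<omega> - V0' \<omega>) + (\<Sum>i=1..N T \<omega>. norm (X i \<omega> - X' i \<omega>))"
    have "((\<lambda>s. blinfun_apply C (V s \<omega> - V' s \<omega>)) has_integral (V t \<omega> - V' t \<omega> - J t)) {0..t}"
      if "t \<in> {0..T}" for t
    proof -
      have "((\<lambda>s. blinfun_apply C (V s \<omega>) - blinfun_apply C (V' s \<omega>)) has_integral
          (V t \<omega> - V0 \<omega> - (jump_sum N X t \<omega> - jump_sum N X 0 \<omega>)) -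
          (V' t \<omega> - V0' \<omega> - (jump_sum N X' t \<omega> - jump_sum N X' 0 \<omega>))) {0..t}"
        using elim(3,4) that by (intro has_integral_diff) auto
      then show ?thesis
        using elim(1) by (simp add: jump_sum_def J_def blinfun.diff_right sum_subtractf algebra_simps)
    qed
    moreover have "norm (J t) \<le> a" if "t \<in> {0..T}" for t
    proof -
      have "norm (J t) \<le> norm (V0 \<omega> - V0' \<omega>) + (\<Sum>i=1..N t \<omega>. norm (X i \<omega> - X' i \<omega>))"
        unfolding J_def by (rule norm_triangle_le) (intro add_left_mono norm_sum)
      also have "(\<Sum>i=1..N t \<omega>. norm (X i \<omega> - X' i \<omega>)) \<le> (\<Sum>i=1..N T \<omega>. norm (X i \<omega> - X' i \<omega>))"
        using elim(2) that by (intro sum_mono2) auto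
      finally show ?thesis by (simp add: a_def)
    qed
    ultimately show ?case
      unfolding a_def[symmetric] by (intro ballI linear_integral_equation_bound)
  qed
qed

text \<open>
  The supremum over uncountably many times need not be measurable. It enters only as the smaller
  side of a pointwise inequality, where monotonicity of the nonnegative integral asks for no
  measurability.
\<close>
lemma (in prob_space) linear_sde_solution_stability:
  fixes C :: "'b::{banach, second_countable_topology} \<Rightarrow>\<^sub>L 'b"
    and X X' :: "nat \<Rightarrow> 'a \<Rightarrow> 'b"
  assumes N: "poisson_process M l N" and l: "l > 0" and T: "T > 0"
    and V: "linear_sde_solution M C (jump_sum N X) V0 V"
    and V': "linear_sde_solution M C (jump_sum N X') V0' V'"
    and V0: "V0 \<in> borel_measurable M" "V0' \<in> borel_measurable M"
    and ind: "indep_process_seq M N (\<lambda>i \<omega>. X i \<omega> - X' i \<omega>)"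
    and meas: "\<And>i. i \<ge> 1 \<Longrightarrow> (\<lambda>\<omega>. X i \<omega> - X' i \<omega>) \<in> borel_measurable M"
    and law: "\<And>i. i \<ge> 1 \<Longrightarrow> distr M borel (\<lambda>\<omega>. X i \<omega> - X' i \<omega>) = distr M borel (\<lambda>\<omega>. X 1 \<omega> - X' 1 \<omega>)"
  shows "(\<integral>\<^sup>+\<omega>. (SUP t\<in>{0..T}. ennreal ((norm (V t \<omega> - V' t \<omega>))\<^sup>2)) \<partial>M)
    \<le> ennreal (2 * exp (2 * T * norm C)) * (\<integral>\<^sup>+\<omega>. ennreal ((norm (V0 \<omega> - V0' \<omega>))\<^sup>2) \<partial>M) +
      ennreal (2 * exp (2 * T * norm C) * (l * T * (1 + l * T))) *
        (\<integral>\<^sup>+\<omega>. ennreal ((norm (X 1 \<omega> - X' 1 \<omega>))\<^sup>2) \<partial>M)"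
proof -
  define E where "E = 2 * exp (2 * T * norm C)"
  define d where "d \<omega> = norm (V0 \<omega> - V0' \<omega>)" for \<omega>
  define S where "S \<omega> = (\<Sum>i=1..N T \<omega>. norm (X i \<omega> - X' i \<omega>))" for \<omega>
  have E: "0 \<le> E" by (simp add: E_def)
  have [measurable]: "d \<in> borel_measurable M" using V0 unfolding d_def by measurable
  have "N T \<in> measurable M (count_space UNIV)" using N T by (simp add: poisson_process_def)
  then have "jump_sum N (\<lambda>i \<omega>. norm (X i \<omega> - X' i \<omega>)) T \<in> borel_measurable M"
    using meas by (intro measurable_jump_sum measurable_compose[OF meas borel_measurable_norm])
  then have [measurable]: "S \<in> borel_measurable M" by (simp add: S_def[abs_def] jump_sum_def[abs_def])
  have "(\<integral>\<^sup>+\<omega>. (SUP t\<in>{0..T}. ennreal ((norm (V t \<omega> - V' t \<omega>))\<^sup>2)) \<partial>M)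
      \<le> (\<integral>\<^sup>+\<omega>. ennreal E * ennreal ((d \<omega>)\<^sup>2) + ennreal E * ennreal ((S \<omega>)\<^sup>2) \<partial>M)"
  proof (rule nn_integral_mono_AE)
    show "AE \<omega> in M. (SUP t\<in>{0..T}. ennreal ((norm (V t \<omega> - V' t \<omega>))\<^sup>2))
        \<le> ennreal E * ennreal ((d \<omega>)\<^sup>2) + ennreal E * ennreal ((S \<omega>)\<^sup>2)"
      using linear_sde_solution_diff_bound_AE[OF N V V', of T]
    proof eventually_elim
      case (elim \<omega>)
      show ?case
      proof (rule SUP_least)
        fix t assume t: "t \<in> {0..T}"
        have "(norm (V t \<omega> - V' t \<omega>))\<^sup>2 \<le> ((d \<omega> + S \<omega>) * exp (norm C * T))\<^sup>2"
          using elim t unfolding d_def S_def by (intro power_mono) auto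
        also have "\<dots> = (d \<omega> + S \<omega>)\<^sup>2 * exp (2 * T * norm C)"
          by (simp add: power_mult_distrib mult_ac flip: exp_double)
        also have "(d \<omega> + S \<omega>)\<^sup>2 \<le> 2 * ((d \<omega>)\<^sup>2 + (S \<omega>)\<^sup>2)"
          using zero_le_power2[of "d \<omega> - S \<omega>"] by (simp add: power2_sum power2_diff)
        finally have "(norm (V t \<omega> - V' t \<omega>))\<^sup>2 \<le> E * (d \<omega>)\<^sup>2 + E * (S \<omega>)\<^sup>2"
          by (simp add: E_def algebra_simps)
        then show "ennreal ((norm (V t \<omega> - V' t \<omega>))\<^sup>2)
            \<le> ennreal E * ennreal ((d \<omega>)\<^sup>2) + ennreal E * ennreal ((S \<omega>)\<^sup>2)"
          using E by (simp add: ennreal_leI flip: ennreal_mult ennreal_plus)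
      qed
    qed
  qed
  also have "\<dots> = ennreal E * (\<integral>\<^sup>+\<omega>. ennreal ((d \<omega>)\<^sup>2) \<partial>M) + ennreal E * (\<integral>\<^sup>+\<omega>. ennreal ((S \<omega>)\<^sup>2) \<partial>M)"
    by (simp add: nn_integral_add nn_integral_cmult)
  also have "(\<integral>\<^sup>+\<omega>. ennreal ((S \<omega>)\<^sup>2) \<partial>M)
      \<le> ennreal (l * T * (1 + l * T)) * (\<integral>\<^sup>+\<omega>. ennreal ((norm (X 1 \<omega> - X' 1 \<omega>))\<^sup>2) \<partial>M)"
    unfolding S_def using T by (intro poisson_random_sum_second_moment[OF N l _ ind meas law]) auto
  finally show ?thesis
    using E l T by (simp add: E_def d_def ennreal_mult' mult.assoc mult_left_mono add_left_mono)
qed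

theorem proposition2:
  fixes M :: "'w measure"
    and l :: real
    and N :: "real \<Rightarrow> 'w \<Rightarrow> nat"
    and X :: "nat \<Rightarrow> 'w \<Rightarrow> 'h::{real_inner, banach, second_countable_topology} hs_op"
    and Xn :: "nat \<Rightarrow> nat \<Rightarrow> 'w \<Rightarrow> 'h hs_op"
    and C :: "'h hs_op \<Rightarrow>\<^sub>L 'h hs_op"
    and Cn :: "nat \<Rightarrow> 'h hs_op \<Rightarrow>\<^sub>L 'h hs_op"
    and V0 :: "'w \<Rightarrow> 'h hs_op"
    and V0n :: "nat \<Rightarrow> 'w \<Rightarrow> 'h hs_op"
    and V :: "real \<Rightarrow> 'w \<Rightarrow> 'h hs_op"
    and Vn :: "nat \<Rightarrow> real \<Rightarrow> 'w \<Rightarrow> 'h hs_op"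
  assumes "prob_space M"
    and "l > 0"
    and "poisson_process M l N"
    and "iid_seq M X"
    and "\<And>n. n \<ge> 1 \<Longrightarrow> iid_seq M (Xn n)"
    and pair_law: "\<And>n i. n \<ge> 1 \<Longrightarrow> i \<ge> 1 \<Longrightarrow>
      distr M borel (\<lambda>\<omega>. (X i \<omega>, Xn n i \<omega>)) = distr M borel (\<lambda>\<omega>. (X 1 \<omega>, Xn n 1 \<omega>))"
    and "\<And>n. n \<ge> 1 \<Longrightarrow> indep_process_seq M N (\<lambda>i \<omega>. (X i \<omega>, Xn n i \<omega>))"
    and "\<And>i. i \<ge> 1 \<Longrightarrow> integrable M (\<lambda>\<omega>. (norm (X i \<omega>))\<^sup>2)"
    and "\<And>n i. n \<ge> 1 \<Longrightarrow> i \<ge> 1 \<Longrightarrow> integrable M (\<lambda>\<omega>. (norm (Xn n i \<omega>))\<^sup>2)"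
    and "\<And>n. n \<ge> 1 \<Longrightarrow> Cn n = C"
    and "V0 \<in> borel_measurable M"
    and "\<And>n. n \<ge> 1 \<Longrightarrow> V0n n \<in> borel_measurable M"
    and "linear_sde_solution M C (jump_sum N X) V0 V"
    and "\<And>n. n \<ge> 1 \<Longrightarrow> linear_sde_solution M (Cn n) (jump_sum N (Xn n)) (V0n n) (Vn n)"
  shows "compound_poisson_process M l (jump_sum N X) \<and>
    square_integrable_process M (jump_sum N X) \<and>
    (\<forall>n\<ge>1. compound_poisson_process M l (jump_sum N (Xn n)) \<and>
      square_integrable_process M (jump_sum N (Xn n))) \<and>
    (\<forall>n\<ge>1. \<forall>T>0.
      (\<integral>\<^sup>+\<omega>. (SUP t\<in>{0..T}. ennreal ((norm (V t \<omega> - Vn n t \<omega>))\<^sup>2)) \<partial>M)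
        \<le> ennreal (2 * exp (2 * T * norm C)) *
            (\<integral>\<^sup>+\<omega>. ennreal ((norm (V0 \<omega> - V0n n \<omega>))\<^sup>2) \<partial>M) +
          ennreal (2 * exp (2 * T * norm C) * T * l * (1 + l * T) * exp (2 * T * norm C)) *
            (\<integral>\<^sup>+\<omega>. ennreal ((norm (X 1 \<omega> - Xn n 1 \<omega>))\<^sup>2) \<partial>M))"
proof -
  interpret prob_space M by fact
  note l = \<open>l > 0\<close> and N = \<open>poisson_process M l N\<close>
  note ind = \<open>\<And>n. n \<ge> 1 \<Longrightarrow> indep_process_seq M N (\<lambda>i \<omega>. (X i \<omega>, Xn n i \<omega>))\<close>
  note iid = \<open>iid_seq M X\<close> and iidn = \<open>\<And>n. n \<ge> 1 \<Longrightarrow> iid_seq M (Xn n)\<close>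
  have X: "X i \<in> borel_measurable M" if "i \<ge> 1" for i
    using iid that by (auto simp: iid_seq_def indep_vars_def)
  have Xn: "Xn n i \<in> borel_measurable M" if "n \<ge> 1" "i \<ge> 1" for n i
    using iidn[OF that(1)] that(2) by (auto simp: iid_seq_def indep_vars_def)
  have indX: "indep_process_seq M N X"
    using indep_process_seq_compose[OF ind[of 1], of fst]
    by (simp add: borel_measurable_continuous_onI continuous_on_fst)
  have indXn: "indep_process_seq M N (Xn n)" if "n \<ge> 1" for n
    using indep_process_seq_compose[OF ind[OF that], of snd]
    by (simp add: borel_measurable_continuous_onI continuous_on_snd)
  have "compound_poisson_process M l (jump_sum N X)"
    unfolding compound_poisson_process_def using N iid indX by blast
  moreover have "square_integrable_process M (jump_sum N X)"
    using assms(8) by (intro jump_sum_square_integrable[OF N l indX iid]) simp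
  moreover have "compound_poisson_process M l (jump_sum N (Xn n))" if "n \<ge> 1" for n
    unfolding compound_poisson_process_def using N iidn[OF that] indXn[OF that] by blast
  moreover have "square_integrable_process M (jump_sum N (Xn n))" if "n \<ge> 1" for n
    using assms(9) that by (intro jump_sum_square_integrable[OF N l indXn iidn]) simp_all
  moreover have "(\<integral>\<^sup>+\<omega>. (SUP t\<in>{0..T}. ennreal ((norm (V t \<omega> - Vn n t \<omega>))\<^sup>2)) \<partial>M)
        \<le> ennreal (2 * exp (2 * T * norm C)) *
            (\<integral>\<^sup>+\<omega>. ennreal ((norm (V0 \<omega> - V0n n \<omega>))\<^sup>2) \<partial>M) +
          ennreal (2 * exp (2 * T * norm C) * T * l * (1 + l * T) * exp (2 * T * norm C)) *
            (\<integral>\<^sup>+\<omega>. ennreal ((norm (X 1 \<omega> - Xn n 1 \<omega>))\<^sup>2) \<partial>M)"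
    if n: "n \<ge> 1" and T: "T > 0" for n T
  proof -
    let ?diff = "\<lambda>(x, y). x - y :: 'h hs_op"
    have diff[measurable]: "?diff \<in> borel_measurable borel"
      by (intro borel_measurable_continuous_onI) (simp add: case_prod_beta continuous_intros)
    have "indep_process_seq M N (\<lambda>i \<omega>. X i \<omega> - Xn n i \<omega>)"
      using indep_process_seq_compose[OF ind[OF n] diff] by simp
    moreover have "(\<lambda>\<omega>. X i \<omega> - Xn n i \<omega>) \<in> borel_measurable M" if "i \<ge> 1" for i
      using X[OF that] Xn[OF n that] by (rule borel_measurable_diff)
    moreover have "distr M borel (\<lambda>\<omega>. X i \<omega> - Xn n i \<omega>) = distr M borel (\<lambda>\<omega>. X 1 \<omega> - Xn n 1 \<omega>)"
      if "i \<ge> 1" for i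
    proof -
      have push: "distr M borel (\<lambda>\<omega>. X j \<omega> - Xn n j \<omega>)
          = distr (distr M borel (\<lambda>\<omega>. (X j \<omega>, Xn n j \<omega>))) borel ?diff" if "j \<ge> 1" for j
        using X[OF that] Xn[OF n that] diff
        by (subst distr_distr) (auto simp: comp_def intro: borel_measurable_Pair)
      show ?thesis unfolding push[OF that] push[OF le_refl] pair_law[OF n that] ..
    qed
    moreover have "linear_sde_solution M C (jump_sum N (Xn n)) (V0n n) (Vn n)"
      using assms(10,14)[OF n] by simp
    ultimately have "(\<integral>\<^sup>+\<omega>. (SUP t\<in>{0..T}. ennreal ((norm (V t \<omega> - Vn n t \<omega>))\<^sup>2)) \<partial>M)
      \<le> ennreal (2 * exp (2 * T * norm C)) *
          (\<integral>\<^sup>+\<omega>. ennreal ((norm (V0 \<omega> - V0n n \<omega>))\<^sup>2) \<partial>M) +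
        ennreal (2 * exp (2 * T * norm C) * (l * T * (1 + l * T))) *
          (\<integral>\<^sup>+\<omega>. ennreal ((norm (X 1 \<omega> - Xn n 1 \<omega>))\<^sup>2) \<partial>M)"
      by (intro linear_sde_solution_stability[OF N l T assms(13)] assms(11) assms(12)[OF n])
    also have "ennreal (2 * exp (2 * T * norm C) * (l * T * (1 + l * T)))
        \<le> ennreal (2 * exp (2 * T * norm C) * T * l * (1 + l * T) * exp (2 * T * norm C))"
    proof (rule ennreal_leI)
      have "0 \<le> 2 * exp (2 * T * norm C) * (l * T * (1 + l * T))" using l T by simp
      moreover have "1 \<le> exp (2 * T * norm C)" using T by simp
      ultimately show "2 * exp (2 * T * norm C) * (l * T * (1 + l * T))
          \<le> 2 * exp (2 * T * norm C) * T * l * (1 + l * T) * exp (2 * T * norm C)"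
        using mult_left_mono[of 1 "exp (2 * T * norm C)"] by (fastforce simp: mult_ac)
    qed
    finally show ?thesis by (simp add: add_left_mono mult_right_mono)
  qed
  ultimately show ?thesis by blast
qed

end
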